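(* Let $S_n$ be the set of histograms (piecewise constant functions) on the partition $\{[k/d_n,(k+1)/d_n):\ k=0,\dots,d_n-1\}$ of $[0,1)$, and let $S_m$ be the linear subspace of $S_n$ of histograms on $\{[k/d_m,(k+1)/d_m):\ k=0,\dots,d_m-1\}$. Let $\alpha,\beta$ be real numbers in $(0,1)$ such that $2\alpha+\beta<1$. There exists a constant $C(\alpha,\beta)>0$, depending only on $\alpha$ and $\beta$, such that $$\phi_n^2(\alpha,\beta,S_n,S_m)\ \ge\ C(\alpha,\beta)\left(\frac{\sqrt{d_n}}{n}\vee\frac{d_m}{n}\right).$$
   Context: $\mu$ is Lebesgue measure on $\mathbb R$, $\|\cdot\|$ the $L^2(\mu)$-norm, $a\vee b=\max(a,b)$; $d_n,d_m$ are positive integers and $n$ is the sample size. Histograms are extended by $0$ outside $[0,1)$. A density is a probability density with respect to $\mu$; $\mathbb P_s$ is the law of an i.i.d. sample $X_1,\dots,X_n$ with common density $s$. For $S\subset L^2(\mu)$, $S^*$ is the set of densities in $S$. For $\beta\in(0,1)$, $CS(S,\beta)$ is the set of all random balls $\hat B_\beta=\{t\in S:\ \|t-\hat s\|\le\hat\rho_\beta\}$, with $\hat s$ (an $L^2(\mu)$-valued estimator) and $\hat\rho_\beta$ (real) measurable with respect to $\sigma(X_1,\dots,X_n)$, such that $\mathbb P_s(s\in\hat B_\beta)\ge1-\beta$ for all $s\in S^*$. $\Delta(\mathcal F)=\sup_{t,t'\in\mathcal F}\|t-t'\|$ is the $L^2$-diameter, and for a random set $\hat B$, $\Delta_{(S',\alpha)}(\hat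 B)=\inf\{\delta>0:\ \sup_{s\in S'^*}\mathbb P_s(\Delta(\hat B)>\delta)\le\alpha\}$. For $S'\subset S$, the $(\alpha,\beta)$-minimax rate of convergence over $S'$ for confidence sets on $S$ is $$\phi_n(\alpha,\beta,S,S')=\inf_{\hat B_\beta\in CS(S,\beta)}\Delta_{(S',\alpha)}(\hat B_\beta).$$
   Formalization: The formal theorem assumes d_n ≥ 2: for d_n = d_m = 1 the only density in S_n is the indicator of [0,1), so the ball centred there with radius 0 is a valid confidence set of diameter 0 and the claimed bound C/n > 0 fails. *)

theory Defs
  imports "HOL-Probability.Probability"
begin

text \<open>Elements of $L^2(\mu)$ are represented by square-integrable Borel functions rather than
  by classes modulo almost-everywhere equality; two representatives of a class are at
  distance 0.\<close>

definition L2_functions :: "(real \<Rightarrow> real) set" where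
  "L2_functions = {f \<in> borel_measurable lborel. integrable lborel (\<lambda>x. (f x)\<^sup>2)}"

definition l2norm :: "(real \<Rightarrow> real) \<Rightarrow> real" where
  "l2norm f = sqrt (LINT x|lborel. (f x)\<^sup>2)"

definition l2dist :: "(real \<Rightarrow> real) \<Rightarrow> (real \<Rightarrow> real) \<Rightarrow> real" where
  "l2dist f g = l2norm (\<lambda>x. f x - g x)"

text \<open>The open sets below are saturated for almost-everywhere equality, so \<open>L2_borel\<close> is
  the pullback to representatives of the Borel \<open>\<sigma>\<close>-algebra of $L^2(\mu)$.\<close>

definition L2_open :: "(real \<Rightarrow> real) set \<Rightarrow> bool" where
  "L2_open U \<longleftrightarrow> U \<subseteq> L2_functions \<and>
     (\<forall>f\<in>U. \<exists>e>0. \<forall>g\<in>L2_functions. l2dist g f < e \<longrightarrow> g \<in> U)"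

definition L2_borel :: "(real \<Rightarrow> real) measure" where
  "L2_borel = sigma L2_functions {U. L2_open U}"

definition densities :: "(real \<Rightarrow> real) set \<Rightarrow> (real \<Rightarrow> real) set" where
  "densities S = {s \<in> S. s \<in> borel_measurable lborel \<and> (AE x in lborel. 0 \<le> s x) \<and>
     (\<integral>\<^sup>+x. ennreal (s x) \<partial>lborel) = 1}"

text \<open>Intended for \<open>d \<ge> 1\<close>.\<close>

definition histograms :: "nat \<Rightarrow> (real \<Rightarrow> real) set" where
  "histograms d = {f. (\<forall>k<d. f constant_on {real k / real d ..< (real k + 1) / real d}) \<and>
     (\<forall>x. x \<notin> {0..<1} \<longrightarrow> f x = 0)}"

text \<open>The sample is the coordinate process on the canonical space of \<open>n\<close>-tuples, so that
  \<open>\<sigma>\<close>-measurability with respect to the sample is measurability on \<open>sample_space n\<close>,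
  and $\mathbb P_s$ is \<open>sample_law n s\<close>.\<close>

definition sample_space :: "nat \<Rightarrow> (nat \<Rightarrow> real) measure" where
  "sample_space n = PiM {..<n} (\<lambda>_. borel)"

definition sample_law :: "nat \<Rightarrow> (real \<Rightarrow> real) \<Rightarrow> (nat \<Rightarrow> real) measure" where
  "sample_law n s = PiM {..<n} (\<lambda>_. density lborel (\<lambda>x. ennreal (s x)))"

definition random_ball ::
  "(real \<Rightarrow> real) set \<Rightarrow> ((nat \<Rightarrow> real) \<Rightarrow> real \<Rightarrow> real) \<Rightarrow> ((nat \<Rightarrow> real) \<Rightarrow> real) \<Rightarrow>
     (nat \<Rightarrow> real) \<Rightarrow> (real \<Rightarrow> real) set" where
  "random_ball S s_hat rho_hat X = {t \<in> S. l2dist t (s_hat X) \<le> rho_hat X}"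

definition CS ::
  "nat \<Rightarrow> (real \<Rightarrow> real) set \<Rightarrow> real \<Rightarrow> ((nat \<Rightarrow> real) \<Rightarrow> (real \<Rightarrow> real) set) set" where
  "CS n S \<beta> = {random_ball S s_hat rho_hat | s_hat rho_hat.
     s_hat \<in> measurable (sample_space n) L2_borel \<and>
     rho_hat \<in> borel_measurable (sample_space n) \<and>
     (\<forall>s\<in>densities S.
        measure (sample_law n s)
          {X \<in> space (sample_space n). s \<in> random_ball S s_hat rho_hat X} \<ge> 1 - \<beta>)}"

text \<open>Suprema and infima are taken in \<^typ>\<open>ennreal\<close>: the diameter of the empty set is 0 and
  the infimum of the empty set is \<open>\<infinity>\<close>.\<close>

definition diam_L2 :: "(real \<Rightarrow> real) set \<Rightarrow> ennreal" where
  "diam_L2 F = (SUP t\<in>F. SUP t'\<in>F. ennreal (l2dist t t'))"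

definition random_diam ::
  "nat \<Rightarrow> (real \<Rightarrow> real) set \<Rightarrow> real \<Rightarrow> ((nat \<Rightarrow> real) \<Rightarrow> (real \<Rightarrow> real) set) \<Rightarrow> ennreal" where
  "random_diam n S' \<alpha> B = Inf {ennreal \<delta> | \<delta>. \<delta> > 0 \<and>
     (SUP s\<in>densities S'. emeasure (sample_law n s)
        {X \<in> space (sample_space n). diam_L2 (B X) > ennreal \<delta>}) \<le> ennreal \<alpha>}"

definition minimax_rate ::
  "nat \<Rightarrow> real \<Rightarrow> real \<Rightarrow> (real \<Rightarrow> real) set \<Rightarrow> (real \<Rightarrow> real) set \<Rightarrow> ennreal" where
  "minimax_rate n \<alpha> \<beta> S S' = (INF B\<in>CS n S \<beta>. random_diam n S' \<alpha> B)"

end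

theory Submission
  imports Defs
begin

text \<open>
  Put \<open>\<kappa> = 1 - \<alpha> - \<beta> > 0\<close>. Let a confidence ball have diameter at most \<open>\<delta>\<close> with probability
  at least \<open>1 - \<alpha>\<close> under the densities of \<open>S\<^sub>m\<close>, and let it cover every density of \<open>S\<^sub>n\<close> with
  probability at least \<open>1 - \<beta>\<close>. If \<open>\<delta>\<close> is too small, then the ball locates the true density more
  precisely than the sample allows. There are two kinds of densities for which this happens,
  one for each term of the maximum. Both come from one construction: the bins are collected into
  \<open>D\<close> groups of \<open>g\<close> bins, and within each group some mass is moved to a single bin, the
  position of the spike. The locale \<open>spikes\<close> computes norms and likelihoods of these
  densities; all overlaps of likelihoods depend only on the number of groups in which two
  vectors of positions agree.

  The term \<open>sqrt dn / n\<close> (\<open>diameter_ge_sqrt_dimension\<close>). The uniform density belongs to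
  \<open>S\<^sub>m\<close>. Put spikes of a common amplitude at uniformly random positions. As long as the squared
  distance to the uniform density is a small multiple of \<open>sqrt dn / n\<close>, the mixture of
  the resulting sample laws is close to the uniform law in \<open>\<chi>\<^sup>2\<close>-distance (\<open>mean_overlap_le\<close>,
  \<open>mixture_prob_le\<close>). Hence the control of the diameter, which is given on \<open>S\<^sub>m\<close>
  only, passes from the uniform density to the mixture. Comparing the uniform density with one mixture
  leads to a contradiction only if \<open>\<alpha> + 2 * \<beta> < 1\<close>, which \<open>2 * \<alpha> + \<beta> < 1\<close> does not imply. So \<open>K\<close>
  equally spaced amplitudes are used. Densities with different amplitudes are more than \<open>\<delta>\<close> apart,
  so the events ``the ball is small and contains a density with the \<open>k\<close>-th amplitude'' are disjoint. Under
  the uniform law each of them has probability at least \<open>\<kappa> / 2\<close>, because under the \<open>k\<close>-th mixture it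
  has probability close to \<open>\<kappa>\<close> or more. This is impossible for \<open>K > 2 / \<kappa>\<close>
  (\<open>detection_bound\<close>). Groups of two bins suffice when \<open>dn\<close> is at most of order \<open>n\<^sup>2\<close>;
  beyond that a density cannot be that far from the uniform one without high peaks, and groups of
  about \<open>sqrt dn / n\<close> bins provide them.

  The term \<open>dm / n\<close> (\<open>diameter_ge_dimension\<close>). If \<open>dm\<close> is below a constant, then the
  first term dominates. Otherwise take groups of two bins, that is, sign patterns, inside \<open>S\<^sub>m\<close>. A
  ball of squared diameter below a small multiple of \<open>dm / n\<close> contains at most
  \<open>(3/2)^D\<close> of the \<open>2^D\<close> patterns (\<open>card_hamming_cluster_le\<close>), whereas the second moments of
  the likelihood ratios are at most \<open>exp (D/8)\<close>. So a random pattern is covered by a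
  small ball with a probability that decreases exponentially in \<open>D\<close>
  (\<open>average_identification_le\<close>, \<open>estimation_bound\<close>). The base density is
  concentrated on at most of order \<open>n\<close> bins: this keeps the relative amplitude below 1
  also when \<open>dm\<close> is much larger than \<open>n\<close>, and the high base density makes up for the smaller number of patterns.
\<close>

section \<open>The seminorm of square-integrable functions\<close>

lemma L2_functionsI:
  assumes "f \<in> borel_measurable lborel" "integrable lborel (\<lambda>x. (f x)\<^sup>2)"
  shows "f \<in> L2_functions"
  using assms by (simp add: L2_functions_def)

lemma L2_functionsD:
  assumes "f \<in> L2_functions"
  shows "f \<in> borel_measurable borel" "integrable lborel (\<lambda>x. (f x)\<^sup>2)"
  using assms by (simp_all add: L2_functions_def)

lemma L2_mult_integrable:
  assumes "f \<in> L2_functions" "g \<in> L2_functions"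
  shows "integrable lborel (\<lambda>x. f x * g x)"
proof (rule Bochner_Integration.integrable_bound)
  show "integrable lborel (\<lambda>x. (f x)\<^sup>2 + (g x)\<^sup>2)"
    using assms by (simp add: L2_functions_def)
  show "(\<lambda>x. f x * g x) \<in> borel_measurable lborel"
    using assms[THEN L2_functionsD(1)] by simp
  have "\<bar>f x * g x\<bar> \<le> (f x)\<^sup>2 + (g x)\<^sup>2" for x
  proof -
    have "0 \<le> (\<bar>f x\<bar> - \<bar>g x\<bar>)\<^sup>2" by simp
    hence "2 * (\<bar>f x\<bar> * \<bar>g x\<bar>) \<le> (f x)\<^sup>2 + (g x)\<^sup>2"
      by (simp add: power2_diff)
    moreover have "0 \<le> \<bar>f x\<bar> * \<bar>g x\<bar>" by simp
    ultimately show ?thesis unfolding abs_mult by linarith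
  qed
  thus "AE x in lborel. norm (f x * g x) \<le> norm ((f x)\<^sup>2 + (g x)\<^sup>2)"
    by (intro AE_I2) (auto intro: order_trans)
qed

lemma L2_lincomb:
  assumes "f \<in> L2_functions" "g \<in> L2_functions"
  shows "(\<lambda>x. a * f x + b * g x) \<in> L2_functions"
proof (rule L2_functionsI)
  show "(\<lambda>x. a * f x + b * g x) \<in> borel_measurable lborel"
    using assms[THEN L2_functionsD(1)] by simp
  have "(\<lambda>x. (a * f x + b * g x)\<^sup>2) =
    (\<lambda>x. a\<^sup>2 * (f x)\<^sup>2 + b\<^sup>2 * (g x)\<^sup>2 + 2 * a * b * (f x * g x))"
    by (intro ext) (simp add: power2_eq_square algebra_simps)
  thus "integrable lborel (\<lambda>x. (a * f x + b * g x)\<^sup>2)"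
    using assms L2_mult_integrable[OF assms] by (simp add: L2_functions_def)
qed

lemma L2_diff:
  assumes "f \<in> L2_functions" "g \<in> L2_functions"
  shows "(\<lambda>x. f x - g x) \<in> L2_functions"
  using L2_lincomb[OF assms, of 1 "-1"] by simp

lemma l2norm_nonneg [simp]: "0 \<le> l2norm f"
  by (simp add: l2norm_def)

lemma l2norm_square: "(l2norm f)\<^sup>2 = (LINT x|lborel. (f x)\<^sup>2)"
  by (simp add: l2norm_def)

lemma l2dist_nonneg [simp]: "0 \<le> l2dist f g"
  by (simp add: l2dist_def)

lemma l2dist_commute: "l2dist f g = l2dist g f"
  by (simp add: l2dist_def l2norm_def power2_commute)

lemma l2norm_triangle:
  assumes f: "f \<in> L2_functions" and g: "g \<in> L2_functions"
  shows "l2norm (\<lambda>x. f x + g x) \<le> l2norm f + l2norm g"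
proof (rule field_le_epsilon)
  fix e :: real assume "e > 0"
  define a b where "a = l2norm f + e / 2" and "b = l2norm g + e / 2"
  have ab: "a > 0" "b > 0" "l2norm f \<le> a" "l2norm g \<le> b"
    using \<open>e > 0\<close> by (simp_all add: a_def b_def add_nonneg_pos)
  have intf: "integrable lborel (\<lambda>x. (f x)\<^sup>2)" and intg: "integrable lborel (\<lambda>x. (g x)\<^sup>2)"
    using f g by (simp_all add: L2_functions_def)
  \<comment> \<open>Young's inequality with the weights for which equality holds when the norms of
     \<open>f\<close> and \<open>g\<close> are \<open>a\<close> and \<open>b\<close>.\<close>
  have young: "(f x + g x)\<^sup>2 \<le> (1 + b / a) * (f x)\<^sup>2 + (1 + a / b) * (g x)\<^sup>2" for x
  proof -
    have "0 \<le> (b * f x - a * g x)\<^sup>2 / (a * b)" using ab by simp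
    also have "\<dots> = (1 + b / a) * (f x)\<^sup>2 + (1 + a / b) * (g x)\<^sup>2 - (f x + g x)\<^sup>2"
      using ab by (simp add: field_simps power2_eq_square)
    finally show ?thesis by simp
  qed
  have "(l2norm (\<lambda>x. f x + g x))\<^sup>2 \<le> (LINT x|lborel. (1 + b / a) * (f x)\<^sup>2 + (1 + a / b) * (g x)\<^sup>2)"
    unfolding l2norm_square
    using L2_lincomb[OF f g, of 1 1] intf intg young
    by (intro integral_mono) (auto simp: L2_functions_def)
  also have "\<dots> = (1 + b / a) * (l2norm f)\<^sup>2 + (1 + a / b) * (l2norm g)\<^sup>2"
    using intf intg by (simp add: l2norm_square)
  also have "\<dots> \<le> (1 + b / a) * a\<^sup>2 + (1 + a / b) * b\<^sup>2"
    using ab by (intro add_mono mult_left_mono power_mono) auto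
  also have "\<dots> = (a + b)\<^sup>2"
    using ab by (simp add: field_simps power2_eq_square)
  finally have "l2norm (\<lambda>x. f x + g x) \<le> a + b"
    using ab by (simp add: power2_le_iff_abs_le)
  thus "l2norm (\<lambda>x. f x + g x) \<le> l2norm f + l2norm g + e"
    by (simp add: a_def b_def)
qed

lemma l2dist_triangle:
  assumes "f \<in> L2_functions" "g \<in> L2_functions" "h \<in> L2_functions"
  shows "l2dist f h \<le> l2dist f g + l2dist g h"
  using l2norm_triangle[OF L2_diff[OF assms(1,2)] L2_diff[OF assms(2,3)]]
  by (simp add: l2dist_def)

section \<open>Measurability of the distance to an estimator\<close>

lemma space_L2_borel: "space L2_borel = L2_functions"
  unfolding L2_borel_def by (rule space_measure_of) (auto simp: L2_open_def)

lemma l2dist_measurable: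
  assumes S: "S \<in> measurable M L2_borel" and t: "t \<in> L2_functions"
  shows "(\<lambda>X. l2dist t (S X)) \<in> borel_measurable M"
proof (rule borel_measurableI_less)
  fix r
  let ?U = "{f \<in> L2_functions. l2dist t f < r}"
  have "L2_open ?U"
    unfolding L2_open_def
  proof (intro conjI ballI)
    fix f assume f: "f \<in> ?U"
    show "\<exists>e>0. \<forall>g\<in>L2_functions. l2dist g f < e \<longrightarrow> g \<in> ?U"
    proof (intro exI[of _ "r - l2dist t f"] conjI ballI impI)
      fix g assume g: "g \<in> L2_functions" "l2dist g f < r - l2dist t f"
      with l2dist_triangle[OF t _ g(1), of f] f show "g \<in> ?U"
        by (simp add: l2dist_commute[of g f])
    qed (use f in simp)
  qed auto
  hence "?U \<in> sets L2_borel"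
    unfolding L2_borel_def by (subst sets_measure_of) (auto simp: L2_open_def)
  from measurable_sets[OF S this]
  have "S -` ?U \<inter> space M \<in> sets M" .
  also have "S -` ?U \<inter> space M = {X \<in> space M. l2dist t (S X) < r}"
    using measurable_space[OF S] by (auto simp: space_L2_borel)
  finally show "{X \<in> space M. l2dist t (S X) < r} \<in> sets M" .
qed

section \<open>Histograms\<close>

text \<open>The height function \<open>c\<close> is total, but only its values below \<open>d\<close> matter.\<close>

definition hist :: "nat \<Rightarrow> (nat \<Rightarrow> real) \<Rightarrow> real \<Rightarrow> real" where
  "hist d c x = (if x \<in> {0..<1} then c (nat \<lfloor>real d * x\<rfloor>) else 0)"

text \<open>Every integral of histograms reduces to a finite sum through this description of the bins;
  products and differences of histograms are then computed on heights.\<close>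

lemma bin_index:
  assumes "d > 0" "k < d"
  shows "x \<in> {real k / real d ..< (real k + 1) / real d} \<longleftrightarrow>
    x \<in> {0..<1} \<and> nat \<lfloor>real d * x\<rfloor> = k" (is "?l \<longleftrightarrow> ?r")
proof
  assume ?l
  hence x: "real k \<le> real d * x" "real d * x < real k + 1"
    using assms by (simp_all add: field_simps)
  hence "\<lfloor>real d * x\<rfloor> = int k" by (simp add: floor_eq_iff)
  moreover have "0 \<le> x" using x(1) \<open>d > 0\<close>
    by (metis of_nat_0_le_iff of_nat_0_less_iff order_trans zero_le_mult_iff not_le)
  moreover have "real k + 1 \<le> real d" using \<open>k < d\<close> by simp
  hence "real d * x < real d" using x(2) by linarith
  hence "x < 1" using \<open>d > 0\<close>
    by (metis mult.right_neutral mult_less_cancel_left_pos of_nat_0_less_iff)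
  ultimately show ?r by simp
next
  assume r: ?r
  hence "\<lfloor>real d * x\<rfloor> = int k" using assms by auto
  hence "real k \<le> real d * x" "real d * x < real k + 1" by (simp_all add: floor_eq_iff)
  thus ?l using assms by (simp add: field_simps)
qed

lemma bin_index_less:
  assumes "d > 0" "x \<in> {0..<1}"
  shows "nat \<lfloor>real d * x\<rfloor> < d"
proof -
  have "real d * x < real d" "0 \<le> real d * x" using assms by auto
  thus ?thesis by linarith
qed

lemma hist_eq_sum:
  assumes "d > 0"
  shows "hist d c x = (\<Sum>k<d. c k * indicator {real k / real d ..< (real k + 1) / real d} x)"
proof -
  have "(\<Sum>k<d. c k * indicator {real k / real d ..< (real k + 1) / real d} x)
      = (\<Sum>k<d. if x \<in> {0..<1} \<and> nat \<lfloor>real d * x\<rfloor> = k then c k else 0)"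
    using bin_index[OF assms] by (intro sum.cong refl) (auto simp: indicator_def simp del: atLeastLessThan_iff)
  also have "\<dots> = hist d c x"
    using bin_index_less[OF assms] by (auto simp: hist_def simp del: atLeastLessThan_iff)
  finally show ?thesis ..
qed

lemma hist_integral:
  assumes "d > 0"
  shows "has_bochner_integral lborel (hist d c) ((\<Sum>k<d. c k) / real d)"
proof -
  have "has_bochner_integral lborel (\<lambda>x. \<Sum>k<d. c k * indicator {real k / real d ..< (real k + 1) / real d} x)
      (\<Sum>k<d. c k * (1 / real d))"
  proof (intro has_bochner_integral_sum has_bochner_integral_mult_right)
    fix k assume "k \<in> {..<d}"
    let ?l = "real k / real d" and ?u = "(real k + 1) / real d"
    have le: "?l \<le> ?u" by (rule divide_right_mono) auto
    have diff: "?u - ?l = 1 / real d" by (simp add: diff_divide_distrib[symmetric])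
    have "emeasure lborel {?l..<?u} < \<infinity>"
      unfolding emeasure_lborel_Ico[OF le] by simp
    hence "has_bochner_integral lborel (indicator {?l..<?u} :: real \<Rightarrow> real) (measure lborel {?l..<?u})"
      by (intro has_bochner_integral_real_indicator) auto
    thus "has_bochner_integral lborel (indicator {?l..<?u}) (1 / real d)"
      unfolding measure_lborel_Ico[OF le] diff .
  qed
  moreover have "hist d c =
      (\<lambda>x. \<Sum>k<d. c k * indicator {real k / real d ..< (real k + 1) / real d} x)"
    using hist_eq_sum[OF assms] by blast
  ultimately show ?thesis by (simp add: sum_divide_distrib)
qed

lemma hist_borel [measurable]: "d > 0 \<Longrightarrow> hist d c \<in> borel_measurable borel"
  using borel_measurable_has_bochner_integral[OF hist_integral[of d c]] by simp

lemma hist_square: "(\<lambda>x. (hist d c x)\<^sup>2) = hist d (\<lambda>k. (c k)\<^sup>2)"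
  by (auto simp: hist_def)

lemma hist_diff: "(\<lambda>x. hist d c x - hist d c' x) = hist d (\<lambda>k. c k - c' k)"
  by (auto simp: hist_def)

lemma hist_L2: "d > 0 \<Longrightarrow> hist d c \<in> L2_functions"
  using hist_integral[of d "\<lambda>k. (c k)\<^sup>2"]
  by (intro L2_functionsI) (auto simp: hist_square has_bochner_integral_iff)

lemma l2dist_hist:
  assumes "d > 0"
  shows "(l2dist (hist d c) (hist d c'))\<^sup>2 = (\<Sum>k<d. (c k - c' k)\<^sup>2) / real d"
  using hist_integral[OF assms, of "\<lambda>k. (c k - c' k)\<^sup>2"]
  by (simp add: l2dist_def l2norm_square hist_diff hist_square has_bochner_integral_iff)

lemma histograms_eq_range:
  assumes "d > 0"
  shows "histograms d = range (hist d)"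
proof (intro set_eqI iffI)
  fix f assume f: "f \<in> histograms d"
  have "f = hist d (\<lambda>k. f (real k / real d))"
  proof
    fix x
    show "f x = hist d (\<lambda>k. f (real k / real d)) x"
    proof (cases "x \<in> {0..<1}")
      case True
      define k where "k = nat \<lfloor>real d * x\<rfloor>"
      have k: "k < d" using bin_index_less[OF assms True] by (simp add: k_def)
      have "x \<in> {real k / real d ..< (real k + 1) / real d}"
        using bin_index[OF assms k, of x] True by (simp add: k_def)
      moreover have "real k / real d \<in> {real k / real d ..< (real k + 1) / real d}"
        using assms by (simp add: divide_strict_right_mono)
      moreover have "f constant_on {real k / real d ..< (real k + 1) / real d}"
        using f k by (simp add: histograms_def)
      ultimately have "f x = f (real k / real d)"
        unfolding constant_on_def by metis
      thus ?thesis using True by (simp add: hist_def k_def)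
    next
      case False
      hence "hist d (\<lambda>k. f (real k / real d)) x = 0" unfolding hist_def by (rule if_not_P)
      moreover have "\<forall>x. x \<notin> {0..<1} \<longrightarrow> f x = 0"
        using f unfolding histograms_def mem_Collect_eq by (rule conjunct2)
      ultimately show ?thesis using False by metis
    qed
  qed
  thus "f \<in> range (hist d)" by auto
next
  fix f assume "f \<in> range (hist d)"
  then obtain c where c: "f = hist d c" by auto
  show "f \<in> histograms d"
    unfolding histograms_def mem_Collect_eq
  proof (intro conjI allI impI)
    fix k assume k: "k < d"
    show "f constant_on {real k / real d ..< (real k + 1) / real d}"
      unfolding constant_on_def c
      using bin_index[OF assms k] by (intro exI[of _ "c k"]) (auto simp: hist_def simp del: atLeastLessThan_iff)
  qed (auto simp: c hist_def)
qed

lemma histograms_L2: "d > 0 \<Longrightarrow> histograms d \<subseteq> L2_functions"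
  using hist_L2 by (auto simp: histograms_eq_range)

lemma hist_densities:
  assumes "d > 0" "\<And>k. k < d \<Longrightarrow> 0 \<le> c k" "(\<Sum>k<d. c k) = real d"
  shows "hist d c \<in> densities (histograms d)"
proof -
  have nn: "0 \<le> hist d c x" for x
    using assms(2) bin_index_less[OF assms(1), of x] by (auto simp: hist_def)
  moreover have "(\<integral>\<^sup>+x. ennreal (hist d c x) \<partial>lborel) = 1"
    using hist_integral[OF assms(1), of c] nn assms(1,3)
    by (subst nn_integral_eq_integral) (auto simp: has_bochner_integral_iff)
  ultimately show ?thesis
    using assms(1) by (auto simp: densities_def histograms_eq_range)
qed

section \<open>Measurability of the diameter event\<close>

lemma l2norm_scale: "l2norm (\<lambda>x. a * f x) = \<bar>a\<bar> * l2norm f"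
  by (simp add: l2norm_def power_mult_distrib real_sqrt_mult)

text \<open>The parallelogram law along a segment: the last term is the gain by strict convexity.\<close>

lemma l2dist_strict_convex:
  assumes f: "f \<in> L2_functions" and g: "g \<in> L2_functions" and p: "p \<in> L2_functions"
  shows "(l2dist (\<lambda>x. f x + l * (g x - f x)) p)\<^sup>2 =
    (1 - l) * (l2dist f p)\<^sup>2 + l * (l2dist g p)\<^sup>2 - l * (1 - l) * (l2dist f g)\<^sup>2"
proof -
  have i: "integrable lborel (\<lambda>x. (f x - p x)\<^sup>2)" "integrable lborel (\<lambda>x. (g x - p x)\<^sup>2)"
      "integrable lborel (\<lambda>x. (f x - g x)\<^sup>2)"
    using L2_diff[OF f p] L2_diff[OF g p] L2_diff[OF f g] by (auto dest: L2_functionsD(2))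
  have "(\<lambda>x. (f x + l * (g x - f x) - p x)\<^sup>2) =
      (\<lambda>x. (1 - l) * (f x - p x)\<^sup>2 + l * (g x - p x)\<^sup>2 - l * (1 - l) * (f x - g x)\<^sup>2)"
    by (intro ext) (simp add: power2_eq_square algebra_simps)
  thus ?thesis using i by (simp add: l2dist_def l2norm_square)
qed

lemma less_diam_L2_iff:
  assumes "0 \<le> \<delta>"
  shows "ennreal \<delta> < diam_L2 F \<longleftrightarrow> (\<exists>t\<in>F. \<exists>t'\<in>F. \<delta> < l2dist t t')"
  using assms by (simp add: diam_L2_def less_SUP_iff ennreal_less_iff)

definition rational_histograms :: "nat \<Rightarrow> (real \<Rightarrow> real) set" where
  "rational_histograms d = hist d ` (PiE {..<d} (\<lambda>_. \<rat>))"

lemma countable_rational_histograms: "countable (rational_histograms d)"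
  unfolding rational_histograms_def
  by (intro countable_image countable_PiE) (auto simp: countable_rat)

lemma rational_histograms_subset: "d > 0 \<Longrightarrow> rational_histograms d \<subseteq> histograms d"
  by (auto simp: rational_histograms_def histograms_eq_range)

lemma rational_histograms_dense:
  assumes d: "d > 0" and t: "t \<in> histograms d" and e: "e > 0"
  obtains q where "q \<in> rational_histograms d" "l2dist t q < e"
proof -
  obtain c where c: "t = hist d c" using t d by (auto simp: histograms_eq_range)
  have "\<exists>r\<in>\<rat>. c k < r \<and> r < c k + e" for k
    using Rats_dense_in_real[of "c k" "c k + e"] e by auto
  then obtain r where r: "\<And>k. r k \<in> \<rat>" "\<And>k. c k < r k" "\<And>k. r k < c k + e" by metis
  define q where "q = hist d (restrict r {..<d})"
  have "(\<Sum>k<d. (c k - restrict r {..<d} k)\<^sup>2) < (\<Sum>k<d. e\<^sup>2)"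
  proof (rule sum_strict_mono)
    fix k assume k: "k \<in> {..<d}"
    have "\<bar>c k - r k\<bar> < \<bar>e\<bar>" using r[of k] e by auto
    hence "(c k - r k)\<^sup>2 < e\<^sup>2" using abs_le_square_iff[of e "c k - r k"] by linarith
    thus "(c k - restrict r {..<d} k)\<^sup>2 < e\<^sup>2" using k by simp
  qed (use d in auto)
  hence "(l2dist t q)\<^sup>2 < e\<^sup>2"
    using d by (simp add: c q_def l2dist_hist field_simps)
  hence "l2dist t q < e" using e by (simp add: power2_less_imp_less)
  moreover have "q \<in> rational_histograms d"
    unfolding rational_histograms_def q_def using r by auto
  ultimately show ?thesis using that by blast
qed

text \<open>Two histograms of a closed ball that are more than \<open>\<delta>\<close> apart can be moved slightly
  towards each other; by strict convexity they end up in the open ball, where there is room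
  to replace them by rational histograms. This reduces the diameter to countably many
  points.\<close>

lemma ball_contains_far_rational_histograms:
  assumes d: "d > 0" and p: "p \<in> L2_functions" and \<delta>: "0 \<le> \<delta>"
    and t: "t0 \<in> histograms d" "t1 \<in> histograms d" "l2dist t0 p \<le> r" "l2dist t1 p \<le> r"
      "\<delta> < l2dist t0 t1"
  shows "\<exists>q0\<in>rational_histograms d. \<exists>q1\<in>rational_histograms d.
    \<delta> < l2dist q0 q1 \<and> l2dist q0 p \<le> r \<and> l2dist q1 p \<le> r"
proof -
  have L2: "t \<in> L2_functions" if "t \<in> histograms d" for t
    using that histograms_L2[OF d] by auto
  let ?D = "l2dist t0 t1"
  \<comment> \<open>Moving by the proportion \<open>l\<close> costs half of the slack \<open>?D - \<delta>\<close>, as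
     both end points move.\<close>
  define l where "l = (?D - \<delta>) / (4 * ?D)"
  have D: "?D > 0" using t(5) \<delta> by linarith
  have l: "0 < l" "l < 1/2" using t(5) \<delta> D by (simp_all add: l_def field_simps)
  have r: "0 \<le> r" using t(3) l2dist_nonneg order_trans by blast
  have strict: "l2dist (\<lambda>x. f x + l * (g x - f x)) p < r"
    if f: "f \<in> histograms d" "g \<in> histograms d" "l2dist f p \<le> r" "l2dist g p \<le> r" "l2dist f g = ?D"
    for f g
  proof -
    have "(l2dist (\<lambda>x. f x + l * (g x - f x)) p)\<^sup>2
        = (1 - l) * (l2dist f p)\<^sup>2 + l * (l2dist g p)\<^sup>2 - l * (1 - l) * ?D\<^sup>2"
      using l2dist_strict_convex[OF L2[OF f(1)] L2[OF f(2)] p] f(5) by simp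
    also have "\<dots> \<le> (1 - l) * r\<^sup>2 + l * r\<^sup>2 - l * (1 - l) * ?D\<^sup>2"
      using f l by (intro diff_right_mono add_mono mult_left_mono power_mono) auto
    also have "\<dots> = r\<^sup>2 - l * (1 - l) * ?D\<^sup>2" by (simp add: algebra_simps)
    also have "\<dots> < r\<^sup>2" using l D by simp
    finally show ?thesis using r by (rule power2_less_imp_less)
  qed
  have hist_comb: "(\<lambda>x. f x + l * (g x - f x)) \<in> histograms d"
    if "f \<in> histograms d" "g \<in> histograms d" for f g
  proof -
    from that obtain c c' where "f = hist d c" "g = hist d c'"
      using d by (auto simp: histograms_eq_range)
    hence "(\<lambda>x. f x + l * (g x - f x)) = hist d (\<lambda>k. c k + l * (c' k - c k))"
      by (auto simp: hist_def)
    thus ?thesis using d by (auto simp: histograms_eq_range)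
  qed
  define u0 where "u0 = (\<lambda>x. t0 x + l * (t1 x - t0 x))"
  define u1 where "u1 = (\<lambda>x. t1 x + l * (t0 x - t1 x))"
  have u: "u0 \<in> histograms d" "u1 \<in> histograms d" "l2dist u0 p < r" "l2dist u1 p < r"
    unfolding u0_def u1_def using t strict hist_comb l2dist_commute by auto
  have "(\<lambda>x. u0 x - u1 x) = (\<lambda>x. (1 - 2 * l) * (t0 x - t1 x))"
    by (auto simp: u0_def u1_def algebra_simps)
  hence "l2dist u0 u1 = (1 - 2 * l) * ?D"
    using l by (simp add: l2dist_def l2norm_scale)
  also have "\<dots> = ?D - (?D - \<delta>) / 2" using D by (simp add: l_def field_simps)
  finally have far: "\<delta> < l2dist u0 u1" using t(5) by (simp add: field_simps)
  define e where "e = min (min (r - l2dist u0 p) (r - l2dist u1 p)) ((l2dist u0 u1 - \<delta>) / 2)"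
  have "e > 0" using u far by (simp add: e_def)
  then obtain q0 q1 where q: "q0 \<in> rational_histograms d" "l2dist u0 q0 < e"
      "q1 \<in> rational_histograms d" "l2dist u1 q1 < e"
    using rational_histograms_dense[OF d u(1)] rational_histograms_dense[OF d u(2)] by metis
  have qL: "q0 \<in> L2_functions" "q1 \<in> L2_functions"
    using q rational_histograms_subset[OF d] L2 by auto
  have e: "e \<le> r - l2dist u0 p" "e \<le> r - l2dist u1 p"
    by (auto simp: e_def)
  have "e \<le> (l2dist u0 u1 - \<delta>) / 2"
    unfolding e_def by (rule min.cobounded2)
  hence e2: "2 * e \<le> l2dist u0 u1 - \<delta>" by simp
  have "l2dist q0 p \<le> r"
    using l2dist_triangle[OF qL(1) L2[OF u(1)] p] q(2) e(1) by (simp add: l2dist_commute)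
  moreover have "l2dist q1 p \<le> r"
    using l2dist_triangle[OF qL(2) L2[OF u(2)] p] q(4) e(2) by (simp add: l2dist_commute)
  moreover have "\<delta> < l2dist q0 q1"
    using l2dist_triangle[OF L2[OF u(1)] qL(1) L2[OF u(2)]]
      l2dist_triangle[OF qL(1,2) L2[OF u(2)]] q(2,4) e2
    by (simp add: l2dist_commute)
  ultimately show ?thesis using q by blast
qed

text \<open>\<open>emeasure\<close> vanishes on non-measurable sets, so a bound on the probability of a large
  diameter carries information only once this event is known to be measurable.\<close>

lemma diam_event_measurable:
  assumes d: "d > 0" and S[measurable]: "S \<in> measurable M L2_borel"
    and R[measurable]: "R \<in> borel_measurable M" and \<delta>: "0 \<le> \<delta>"
  shows "{X \<in> space M. ennreal \<delta> < diam_L2 (random_ball (histograms d) S R X)} \<in> sets M"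
proof -
  let ?Q = "rational_histograms d"
  have QL: "q \<in> L2_functions" if "q \<in> ?Q" for q
    using that rational_histograms_subset[OF d] histograms_L2[OF d] by auto
  have "{X \<in> space M. ennreal \<delta> < diam_L2 (random_ball (histograms d) S R X)} =
    (\<Union>q0\<in>?Q. \<Union>q1\<in>{q\<in>?Q. \<delta> < l2dist q0 q}.
      {X \<in> space M. l2dist q0 (S X) \<le> R X \<and> l2dist q1 (S X) \<le> R X})" (is "?l = ?r")
  proof (intro set_eqI iffI)
    fix X assume X: "X \<in> ?l"
    then obtain t0 t1 where "t0 \<in> histograms d" "t1 \<in> histograms d" "l2dist t0 (S X) \<le> R X"
        "l2dist t1 (S X) \<le> R X" "\<delta> < l2dist t0 t1"
      by (auto simp: less_diam_L2_iff[OF \<delta>] random_ball_def)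
    moreover have "S X \<in> L2_functions"
      using measurable_space[OF S] X by (auto simp: space_L2_borel)
    ultimately show "X \<in> ?r"
      using ball_contains_far_rational_histograms[OF d _ \<delta>, of "S X" t0 t1 "R X"] X by blast
  next
    fix X assume "X \<in> ?r"
    thus "X \<in> ?l"
      using rational_histograms_subset[OF d]
      by (auto simp: less_diam_L2_iff[OF \<delta>] random_ball_def)
  qed
  moreover have "?r \<in> sets M"
  proof (intro sets.countable_UN'')
    fix q0 q1 assume q: "q0 \<in> ?Q" "q1 \<in> {q\<in>?Q. \<delta> < l2dist q0 q}"
    have "{X \<in> space M. l2dist q (S X) \<le> R X} \<in> sets M" if "q \<in> ?Q" for q
      using l2dist_measurable[OF S QL[OF that]] R by (rule borel_measurable_le)
    thus "{X \<in> space M. l2dist q0 (S X) \<le> R X \<and> l2dist q1 (S X) \<le> R X} \<in> sets M"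
      using q by (intro sets.sets_Collect_conj) auto
  qed (auto intro: countable_rational_histograms countable_subset[OF _ countable_rational_histograms])
  ultimately show ?thesis by simp
qed

section \<open>Likelihood ratios of samples\<close>

lemma PiM_density:
  assumes I: "finite I" and P: "prob_space P" and L[measurable]: "L \<in> borel_measurable P"
    and PL: "prob_space (density P L)"
  shows "PiM I (\<lambda>_. density P L) = density (PiM I (\<lambda>_. P)) (\<lambda>X. \<Prod>i\<in>I. L (X i))"
proof -
  interpret P: prob_space P by fact
  interpret L: prob_space "density P L" by fact
  interpret PP: product_sigma_finite "\<lambda>_. P" ..
  interpret LP: product_sigma_finite "\<lambda>_. density P L" ..
  have sets: "sets (density (PiM I (\<lambda>_. P)) (\<lambda>X. \<Prod>i\<in>I. L (X i))) = sets (PiM I (\<lambda>_. density P L))"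
    unfolding sets_density by (rule sets_PiM_cong) simp_all
  have "density (PiM I (\<lambda>_. P)) (\<lambda>X. \<Prod>i\<in>I. L (X i)) = PiM I (\<lambda>_. density P L)"
  proof (rule LP.PiM_eqI[OF I sets])
    fix A assume A: "\<And>i. i \<in> I \<Longrightarrow> A i \<in> sets (density P L)"
    hence A': "A i \<in> sets P" if "i \<in> I" for i using that by simp
    have box: "Pi\<^sub>E I A \<in> sets (PiM I (\<lambda>_. P))"
      using I A' by (intro sets_PiM_I_finite) auto
    have "emeasure (density (PiM I (\<lambda>_. P)) (\<lambda>X. \<Prod>i\<in>I. L (X i))) (Pi\<^sub>E I A)
        = (\<integral>\<^sup>+X. (\<Prod>i\<in>I. L (X i)) * indicator (Pi\<^sub>E I A) X \<partial>PiM I (\<lambda>_. P))"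
      using I box by (subst emeasure_density) auto
    also have "\<dots> = (\<integral>\<^sup>+X. (\<Prod>i\<in>I. L (X i) * indicator (A i) (X i)) \<partial>PiM I (\<lambda>_. P))"
    proof (rule nn_integral_cong)
      fix X assume X: "X \<in> space (PiM I (\<lambda>_. P))"
      have "indicator (Pi\<^sub>E I A) X = (\<Prod>i\<in>I. indicator (A i) (X i) :: ennreal)"
        using X I by (auto simp: space_PiM indicator_def PiE_iff prod_eq_1_iff split: if_splits)
      thus "(\<Prod>i\<in>I. L (X i)) * indicator (Pi\<^sub>E I A) X = (\<Prod>i\<in>I. L (X i) * indicator (A i) (X i))"
        by (simp add: prod.distrib)
    qed
    also have "\<dots> = (\<Prod>i\<in>I. \<integral>\<^sup>+x. L x * indicator (A i) x \<partial>P)"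
      using I A' by (intro PP.product_nn_integral_prod) auto
    also have "\<dots> = (\<Prod>i\<in>I. emeasure (density P L) (A i))"
      using A' by (intro prod.cong) (auto simp: emeasure_density)
    finally show "emeasure (density (PiM I (\<lambda>_. P)) (\<lambda>X. \<Prod>i\<in>I. L (X i))) (Pi\<^sub>E I A)
        = (\<Prod>i\<in>I. emeasure (density P L) (A i))" .
  qed
  thus ?thesis ..
qed

lemma sample_law_likelihood:
  assumes s0: "s0 \<in> borel_measurable borel" "prob_space (density lborel (\<lambda>x. ennreal (s0 x)))" "\<And>x. 0 \<le> s0 x"
    and L: "L \<in> borel_measurable borel" "\<And>x. 0 \<le> L x"
    and sL: "prob_space (density lborel (\<lambda>x. ennreal (s0 x * L x)))"
  shows "sample_law n (\<lambda>x. s0 x * L x) = density (sample_law n s0) (\<lambda>X. ennreal (\<Prod>i<n. L (X i)))"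
proof -
  let ?P = "density lborel (\<lambda>x. ennreal (s0 x))"
  have eq: "density lborel (\<lambda>x. ennreal (s0 x * L x)) = density ?P (\<lambda>x. ennreal (L x))"
    using s0 L by (subst density_density_eq) (auto simp: ennreal_mult)
  have "PiM {..<n} (\<lambda>_. density ?P (\<lambda>x. ennreal (L x))) =
      density (PiM {..<n} (\<lambda>_. ?P)) (\<lambda>X. \<Prod>i<n. ennreal (L (X i)))"
    using s0 L sL eq by (intro PiM_density) auto
  thus ?thesis using L(2) by (simp add: sample_law_def eq prod_ennreal)
qed

lemma sets_sample_law: "sets (sample_law n s) = sets (sample_space n)"
  unfolding sample_law_def sample_space_def by (rule sets_PiM_cong) simp_all

lemma space_sample_law: "space (sample_law n s) = space (sample_space n)"
  using sets_sample_law by (rule sets_eq_imp_space_eq)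

lemma prob_space_density_lborel:
  assumes "s \<in> densities S"
  shows "prob_space (density lborel (\<lambda>x. ennreal (s x)))"
proof (rule prob_spaceI)
  have "(\<lambda>x. ennreal (s x)) \<in> borel_measurable lborel" "(\<integral>\<^sup>+x. ennreal (s x) \<partial>lborel) = 1"
    using assms by (auto simp: densities_def)
  thus "emeasure (density lborel (\<lambda>x. ennreal (s x))) (space (density lborel (\<lambda>x. ennreal (s x)))) = 1"
    by (subst emeasure_density) auto
qed

lemma prob_space_sample_law:
  assumes "s \<in> densities S"
  shows "prob_space (sample_law n s)"
  unfolding sample_law_def using prob_space_density_lborel[OF assms] by (intro prob_space_PiM) 

text \<open>Observations are independent, so the overlap of two likelihoods for \<open>n\<close> observations is the
  \<open>n\<close>-th power of the overlap for one.\<close>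

lemma likelihood_product_moment:
  fixes f :: "'a \<Rightarrow> real"
  assumes P: "prob_space P" and f: "integrable P f"
  shows "has_bochner_integral (PiM {..<n} (\<lambda>_. P)) (\<lambda>X. \<Prod>i<n. f (X i)) ((integral\<^sup>L P f) ^ n)"
proof -
  interpret P: prob_space P by fact
  interpret product_sigma_finite "\<lambda>_. P" ..
  show ?thesis
    using product_integral_prod[of "{..<n}" "\<lambda>_. f"] product_integrable_prod[of "{..<n}" "\<lambda>_. f"] f
    by (simp add: has_bochner_integral_iff)
qed

text \<open>The average overlap is the second moment of the density of the mixture; the excess over 1 is
  the square of the \<open>\<chi>\<^sup>2\<close>-distance to \<open>M\<close>, which dominates the distance in total
  variation.\<close>

lemma (in prob_space) mixture_prob_le:
  assumes V: "finite V" "V \<noteq> {}" and \<eta>: "\<eta> > 0" and A: "A \<in> events"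
    and one: "\<And>v. v \<in> V \<Longrightarrow> has_bochner_integral M (\<Lambda> v) (1::real)"
    and overlap: "\<And>v w. v \<in> V \<Longrightarrow> w \<in> V \<Longrightarrow> has_bochner_integral M (\<lambda>X. \<Lambda> v X * \<Lambda> w X) (c v w)"
    and mean: "(\<Sum>v\<in>V. \<Sum>w\<in>V. c v w) \<le> (1 + \<eta>\<^sup>2) * (real (card V))\<^sup>2"
  shows "(\<Sum>v\<in>V. LINT X|M. \<Lambda> v X * indicator A X) / card V \<le> prob A + \<eta>"
proof -
  define N where "N = real (card V)"
  have N: "N > 0" using V by (simp add: N_def card_gt_0_iff)
  define m where "m = (\<lambda>X. (\<Sum>v\<in>V. \<Lambda> v X) / N)"
  have "has_bochner_integral M m ((\<Sum>v\<in>V. 1) / N)"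
    using N unfolding m_def by (intro has_bochner_integral_divide has_bochner_integral_sum one)
  hence m1: "has_bochner_integral M m 1" using N by (simp add: N_def)
  have "m X * m X = (\<Sum>v\<in>V. \<Sum>w\<in>V. \<Lambda> v X * \<Lambda> w X) / (N * N)" for X
    by (simp add: m_def sum_product)
  moreover have "has_bochner_integral M (\<lambda>X. (\<Sum>v\<in>V. \<Sum>w\<in>V. \<Lambda> v X * \<Lambda> w X) / (N * N))
      ((\<Sum>v\<in>V. \<Sum>w\<in>V. c v w) / (N * N))"
    using overlap N by (intro has_bochner_integral_divide has_bochner_integral_sum) auto
  ultimately have m2: "has_bochner_integral M (\<lambda>X. m X * m X) ((\<Sum>v\<in>V. \<Sum>w\<in>V. c v w) / (N * N))"
    by simp
  have le: "(\<Sum>v\<in>V. \<Sum>w\<in>V. c v w) / (N * N) \<le> 1 + \<eta>\<^sup>2"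
    using mean N by (simp add: N_def[symmetric] power2_eq_square field_simps)
  have mA: "integrable M (\<lambda>X. m X * indicator A X)"
    using m1 A by (intro integrable_real_mult_indicator) (auto simp: has_bochner_integral_iff)
  \<comment> \<open>The inequality between arithmetic and geometric mean for \<open>\<eta>\<close> and
     \<open>(m X - 1)\<^sup>2 / \<eta>\<close> replaces Cauchy--Schwarz.\<close>
  have pointwise: "m X * indicator A X \<le> indicator A X + (\<eta> + (m X * m X - 2 * m X + 1) / \<eta>) / 2" for X
  proof -
    define y where "y = \<eta> + (m X * m X - 2 * m X + 1) / \<eta>"
    have "0 \<le> (m X - 1)\<^sup>2 / \<eta>" using \<eta> by simp
    hence y0: "0 \<le> y" using \<eta> by (simp add: y_def power2_eq_square algebra_simps)
    have "0 \<le> (\<eta> - (m X - 1))\<^sup>2 / \<eta>" using \<eta> by simp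
    also have "\<dots> = y - 2 * (m X - 1)"
      using \<eta> by (simp add: y_def power2_eq_square field_simps)
    finally have "m X \<le> 1 + y / 2" by simp
    with y0 show ?thesis unfolding y_def[symmetric] by (simp add: indicator_def)
  qed
  have bound: "has_bochner_integral M (\<lambda>X. indicator A X + (\<eta> + (m X * m X - 2 * m X + 1) / \<eta>) / 2)
      (prob A + (\<eta> + ((\<Sum>v\<in>V. \<Sum>w\<in>V. c v w) / (N * N) - 2 * 1 + 1) / \<eta>) / 2)"
  proof -
    have "has_bochner_integral M (\<lambda>_. b) b" for b :: real
      by (simp add: has_bochner_integral_iff prob_space)
    moreover have "has_bochner_integral M (indicator A) (prob A)"
      using A by (intro has_bochner_integral_real_indicator) (auto simp: emeasure_eq_measure)
    ultimately show ?thesis using m1 m2 \<eta>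
      by (intro has_bochner_integral_divide has_bochner_integral_add has_bochner_integral_diff
        has_bochner_integral_mult_right) auto
  qed
  have "(\<Sum>v\<in>V. LINT X|M. \<Lambda> v X * indicator A X) / N = (LINT X|M. m X * indicator A X)"
  proof -
    have "integrable M (\<lambda>X. \<Lambda> v X * indicator A X)" if "v \<in> V" for v
      using one[OF that] A by (intro integrable_real_mult_indicator) (auto simp: has_bochner_integral_iff)
    hence "(LINT X|M. (\<Sum>v\<in>V. \<Lambda> v X * indicator A X) / N) = (\<Sum>v\<in>V. LINT X|M. \<Lambda> v X * indicator A X) / N"
      by (simp add: Bochner_Integration.integral_sum)
    moreover have "(\<lambda>X. m X * indicator A X) = (\<lambda>X. (\<Sum>v\<in>V. \<Lambda> v X * indicator A X) / N)"
      by (simp add: m_def sum_distrib_right)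
    ultimately show ?thesis by metis
  qed
  also have "\<dots> \<le> (LINT X|M. indicator A X + (\<eta> + (m X * m X - 2 * m X + 1) / \<eta>) / 2)"
    using bound mA pointwise by (intro integral_mono) (auto simp: has_bochner_integral_iff)
  also have "\<dots> = prob A + (\<eta> + ((\<Sum>v\<in>V. \<Sum>w\<in>V. c v w) / (N * N) - 2 * 1 + 1) / \<eta>) / 2"
    using bound by (rule has_bochner_integral_integral_eq)
  also have "\<dots> \<le> prob A + (\<eta> + (1 + \<eta>\<^sup>2 - 1) / \<eta>) / 2"
    using le \<eta> by (intro add_left_mono divide_right_mono) auto
  also have "\<dots> = prob A + \<eta>" using \<eta> by (simp add: power2_eq_square)
  finally show ?thesis by (simp add: N_def)
qed

text \<open>Draw \<open>v\<close> uniformly, then \<open>X\<close> from the law with density \<open>\<Lambda> v\<close>; the left-hand side is the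
  probability of \<open>X \<in> A v\<close>. If \<open>X\<close> were independent of \<open>v\<close> it would be at most \<open>F\<close>, and the second
  moments of the likelihood ratios bound the effect of the dependence. With
  \<open>\<tau> = sqrt (F / R)\<close> the bound is \<open>sqrt (F * R)\<close>; leaving \<open>\<tau>\<close> free avoids roots.\<close>

lemma (in prob_space) average_identification_le:
  assumes V: "finite V" "V \<noteq> {}" and \<tau>: "\<tau> > 0" and A: "\<And>v. v \<in> V \<Longrightarrow> A v \<in> events"
    and one: "\<And>v. v \<in> V \<Longrightarrow> has_bochner_integral M (\<Lambda> v) (1::real)"
    and second: "\<And>v. v \<in> V \<Longrightarrow> has_bochner_integral M (\<lambda>X. \<Lambda> v X * \<Lambda> v X) R"
    and few: "\<And>X. X \<in> space M \<Longrightarrow> real (card {v \<in> V. X \<in> A v}) \<le> F * real (card V)"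
  shows "(\<Sum>v\<in>V. LINT X|M. \<Lambda> v X * indicator (A v) X) / card V \<le> (\<tau> * R + F / \<tau>) / 2"
proof -
  define N where "N = real (card V)"
  have N: "N > 0" using V by (simp add: N_def card_gt_0_iff)
  have "(LINT X|M. \<Lambda> v X * indicator (A v) X) \<le> (LINT X|M. (\<tau> * (\<Lambda> v X * \<Lambda> v X) + indicator (A v) X / \<tau>) / 2)"
    if v: "v \<in> V" for v
  proof (rule integral_mono)
    show "integrable M (\<lambda>X. \<Lambda> v X * indicator (A v) X)"
      using one[OF v] A[OF v] by (intro integrable_real_mult_indicator) (auto simp: has_bochner_integral_iff)
    show "integrable M (\<lambda>X. (\<tau> * (\<Lambda> v X * \<Lambda> v X) + indicator (A v) X / \<tau>) / 2)"
      using second[OF v] A[OF v]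
      by (intro integrable_divide Bochner_Integration.integrable_add integrable_mult_right)
        (auto simp: has_bochner_integral_iff emeasure_eq_measure intro!: integrable_real_indicator)
    fix X
    have "0 \<le> (\<tau> * \<Lambda> v X - 1)\<^sup>2 / \<tau>" "0 \<le> \<tau> * (\<Lambda> v X * \<Lambda> v X)" using \<tau> by auto
    thus "\<Lambda> v X * indicator (A v) X \<le> (\<tau> * (\<Lambda> v X * \<Lambda> v X) + indicator (A v) X / \<tau>) / 2"
      using \<tau> by (auto simp: indicator_def power2_eq_square field_simps)
  qed
  moreover have "(LINT X|M. (\<tau> * (\<Lambda> v X * \<Lambda> v X) + indicator (A v) X / \<tau>) / 2) = (\<tau> * R + prob (A v) / \<tau>) / 2"
    if v: "v \<in> V" for v
  proof -
    have "has_bochner_integral M (indicator (A v)) (prob (A v))"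
      using A[OF v] by (intro has_bochner_integral_real_indicator) (auto simp: emeasure_eq_measure)
    hence "has_bochner_integral M (\<lambda>X. (\<tau> * (\<Lambda> v X * \<Lambda> v X) + indicator (A v) X / \<tau>) / 2) ((\<tau> * R + prob (A v) / \<tau>) / 2)"
      using second[OF v] \<tau>
      by (intro has_bochner_integral_divide has_bochner_integral_add has_bochner_integral_mult_right) auto
    thus ?thesis by (rule has_bochner_integral_integral_eq)
  qed
  ultimately have "(\<Sum>v\<in>V. LINT X|M. \<Lambda> v X * indicator (A v) X) \<le> (\<Sum>v\<in>V. (\<tau> * R + prob (A v) / \<tau>) / 2)"
    by (intro sum_mono) auto
  also have "\<dots> = (\<tau> * R * N + (\<Sum>v\<in>V. prob (A v)) / \<tau>) / 2"
    by (simp add: N_def sum.distrib sum_divide_distrib[symmetric])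
  also have "(\<Sum>v\<in>V. prob (A v)) \<le> F * N"
  proof -
    have "(\<Sum>v\<in>V. prob (A v)) = (LINT X|M. (\<Sum>v\<in>V. indicator (A v) X))"
      using A by (subst Bochner_Integration.integral_sum) (auto simp: emeasure_eq_measure intro!: integrable_real_indicator)
    also have "\<dots> \<le> (LINT X|M. F * N)"
    proof (rule integral_mono)
      show "integrable M (\<lambda>X. \<Sum>v\<in>V. indicator (A v) X :: real)"
        using A by (auto simp: emeasure_eq_measure intro!: integrable_real_indicator)
      fix X assume "X \<in> space M"
      have "(\<Sum>v\<in>V. indicator (A v) X) = real (card {v \<in> V. X \<in> A v})"
        using V(1) by (simp add: indicator_def sum.If_cases Int_def)
      thus "(\<Sum>v\<in>V. indicator (A v) X) \<le> F * N" using few[OF \<open>X \<in> space M\<close>] by (simp add: N_def)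
    qed simp
    finally show ?thesis by (simp add: prob_space)
  qed
  finally have "(\<Sum>v\<in>V. LINT X|M. \<Lambda> v X * indicator (A v) X) \<le> (\<tau> * R * N + F * N / \<tau>) / 2"
    using \<tau> by (simp add: divide_right_mono)
  thus ?thesis using N by (simp add: N_def[symmetric] field_simps)
qed

section \<open>Densities with spikes\<close>

text \<open>The heights \<open>c0\<close> describe the base density, which is constant on the groups: these consist
  of the first \<open>D * g\<close> bins. The remaining bins are needed when \<open>d\<close> is not a multiple of
  \<open>g\<close>, and to let the base density vanish outside the groups.\<close>

locale spikes =
  fixes n d g D :: nat and h :: real and c0 :: "nat \<Rightarrow> real"
  assumes d: "d > 0" and g: "g > 0" and D: "D > 0" and Dg: "D * g \<le> d"
    and c0_nonneg: "\<And>k. 0 \<le> c0 k" and c0_eq: "\<And>k. k < D * g \<Longrightarrow> c0 k = h"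
    and c0_total: "(\<Sum>k<d. c0 k) = real d"
begin

text \<open>The possible positions of the spikes: \<open>v j\<close> is the bin of group \<open>j\<close> that receives the
  mass.\<close>

definition params :: "(nat \<Rightarrow> nat) set" where
  "params = PiE {..<D} (\<lambda>_. {..<g})"

text \<open>The relative perturbation at amplitude 1. It removes the whole group and stacks its mass on
  the selected bin, so it integrates to 0 over each group. For \<open>g = 2\<close> it is a sign pattern.\<close>

definition spike :: "(nat \<Rightarrow> nat) \<Rightarrow> nat \<Rightarrow> real" where
  "spike v k = (if k < D * g then (if v (k div g) = k mod g then real g - 1 else -1) else 0)"

definition base :: "real \<Rightarrow> real" where
  "base = hist d c0"

definition spiked :: "real \<Rightarrow> (nat \<Rightarrow> nat) \<Rightarrow> real \<Rightarrow> real" where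
  "spiked a v = hist d (\<lambda>k. c0 k * (1 + a * spike v k))"

definition likelihood :: "real \<Rightarrow> (nat \<Rightarrow> nat) \<Rightarrow> (nat \<Rightarrow> real) \<Rightarrow> real" where
  "likelihood a v X = (\<Prod>i<n. hist d (\<lambda>k. 1 + a * spike v k) (X i))"

text \<open>The inner product of the perturbations of \<open>v\<close> and \<open>w\<close>, see \<open>spike_inner\<close>.\<close>

definition agreement :: "(nat \<Rightarrow> nat) \<Rightarrow> (nat \<Rightarrow> nat) \<Rightarrow> real" where
  "agreement v w = (\<Sum>j<D. real g * (real g * of_bool (v j = w j) - 1))"

lemma h_nonneg: "0 \<le> h"
  using c0_nonneg[of 0] c0_eq[of 0] g D by simp

lemma params_finite: "finite params"
  unfolding params_def by (intro finite_PiE) auto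

lemma params_card: "card params = g ^ D"
  unfolding params_def by (simp add: card_PiE)

lemma params_nonempty: "params \<noteq> {}"
  using params_card g by (metis card.empty not_gr_zero zero_less_power)

lemma params_less: "v \<in> params \<Longrightarrow> j < D \<Longrightarrow> v j < g"
  by (auto simp: params_def PiE_iff)

lemma sum_groups:
  fixes F :: "nat \<Rightarrow> nat \<Rightarrow> real"
  shows "(\<Sum>k<D * g. F (k div g) (k mod g)) = (\<Sum>j<D. \<Sum>i<g. F j i)"
proof -
  have "(\<Sum>k<D * g. F (k div g) (k mod g)) = (\<Sum>j<D. \<Sum>k=j*g..<j*g+g. F (k div g) (k mod g))"
    by (rule sum.nat_group[symmetric])
  also have "\<dots> = (\<Sum>j<D. \<Sum>i<g. F j i)"
  proof (rule sum.cong[OF refl])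
    fix j
    have "(\<Sum>k=j*g..<j*g+g. F (k div g) (k mod g)) = (\<Sum>i=0..<g. F ((i + j*g) div g) ((i + j*g) mod g))"
      using sum.shift_bounds_nat_ivl[of "\<lambda>k. F (k div g) (k mod g)" 0 "j*g" g] by (simp add: add.commute)
    also have "\<dots> = (\<Sum>i<g. F j i)"
      by (intro sum.cong) auto
    finally show "(\<Sum>k=j*g..<j*g+g. F (k div g) (k mod g)) = (\<Sum>i<g. F j i)" .
  qed
  finally show ?thesis .
qed

lemma spike_sum:
  assumes "v \<in> params"
  shows "(\<Sum>k<D * g. spike v k) = 0"
proof -
  have "(\<Sum>k<D * g. spike v k) = (\<Sum>k<D * g. real g * of_bool (v (k div g) = k mod g) - 1)"
    by (intro sum.cong) (auto simp: spike_def)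
  also have "\<dots> = (\<Sum>j<D. \<Sum>i<g. real g * of_bool (v j = i) - 1)"
    by (rule sum_groups)
  also have "\<dots> = (\<Sum>j<D. 0)"
  proof (rule sum.cong[OF refl])
    fix j assume "j \<in> {..<D}"
    hence "v j < g" using params_less[OF assms] by auto
    thus "(\<Sum>i<g. real g * of_bool (v j = i) - 1) = 0"
      by (simp add: sum_subtractf sum_distrib_left[symmetric] of_bool_def)
  qed
  finally show ?thesis by simp
qed

lemma spike_inner:
  assumes v: "v \<in> params" and w: "w \<in> params"
  shows "(\<Sum>k<D * g. spike v k * spike w k) = agreement v w"
proof -
  have "(\<Sum>k<D * g. spike v k * spike w k) =
      (\<Sum>k<D * g. (real g * of_bool (v (k div g) = k mod g) - 1) * (real g * of_bool (w (k div g) = k mod g) - 1))"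
    by (intro sum.cong) (auto simp: spike_def)
  also have "\<dots> = (\<Sum>j<D. \<Sum>i<g. (real g * of_bool (v j = i) - 1) * (real g * of_bool (w j = i) - 1))"
    by (rule sum_groups)
  also have "\<dots> = agreement v w"
    unfolding agreement_def
  proof (rule sum.cong[OF refl])
    fix j assume "j \<in> {..<D}"
    hence l: "v j < g" "w j < g" using params_less v w by auto
    have "(\<Sum>i<g. (real g * of_bool (v j = i) - 1) * (real g * of_bool (w j = i) - 1)) =
      (\<Sum>i<g. (real g)\<^sup>2 * of_bool (v j = w j) * of_bool (v j = i) - real g * of_bool (v j = i)
         - real g * of_bool (w j = i) + 1)"
      by (intro sum.cong) (auto simp: power2_eq_square algebra_simps)
    also have "\<dots> = real g * (real g * of_bool (v j = w j) - 1)"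
      using l by (simp add: sum.distrib sum_subtractf sum_distrib_left[symmetric] of_bool_def
        power2_eq_square algebra_simps)
    finally show "(\<Sum>i<g. (real g * of_bool (v j = i) - 1) * (real g * of_bool (w j = i) - 1)) =
      real g * (real g * of_bool (v j = w j) - 1)" .
  qed
  finally show ?thesis .
qed

lemma spike_ge: "-1 \<le> spike v k"
  by (simp add: spike_def)

lemma amplitude_nonneg:
  assumes "0 \<le> a" "a \<le> 1"
  shows "0 \<le> 1 + a * spike v k"
proof -
  have "a * (-1) \<le> a * spike v k" using assms spike_ge by (intro mult_left_mono) auto
  thus ?thesis using assms by simp
qed

lemma sum_spiked_bins:
  assumes "\<And>k. D * g \<le> k \<Longrightarrow> k < d \<Longrightarrow> f k = 0"
  shows "(\<Sum>k<d. f k) = (\<Sum>k<D * g. f k :: real)"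
  using Dg assms by (intro sum.mono_neutral_right) auto

lemma spiked_density:
  assumes v: "v \<in> params" and a: "0 \<le> a" "a \<le> 1"
  shows "spiked a v \<in> densities (histograms d)"
  unfolding spiked_def
proof (rule hist_densities[OF d])
  fix k show "0 \<le> c0 k * (1 + a * spike v k)"
    using c0_nonneg amplitude_nonneg[OF a] by simp
next
  have "(\<Sum>k<d. c0 k * spike v k) = (\<Sum>k<D * g. c0 k * spike v k)"
    by (intro sum_spiked_bins) (simp add: spike_def)
  also have "\<dots> = (\<Sum>k<D * g. h * spike v k)"
    by (intro sum.cong) (auto simp: c0_eq)
  also have "\<dots> = 0" using spike_sum[OF v] by (simp add: sum_distrib_left[symmetric])
  finally have "(\<Sum>k<d. c0 k * spike v k) = 0" .
  moreover have "(\<Sum>k<d. c0 k * (1 + a * spike v k)) = (\<Sum>k<d. c0 k) + a * (\<Sum>k<d. c0 k * spike v k)"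
    by (simp add: sum_distrib_left sum.distrib[symmetric] algebra_simps)
  ultimately show "(\<Sum>k<d. c0 k * (1 + a * spike v k)) = real d"
    using c0_total by simp
qed

lemma spiked_zero: "spiked 0 v = base"
  by (simp add: spiked_def base_def)

lemma base_density: "base \<in> densities (histograms d)"
  unfolding base_def using c0_nonneg c0_total by (intro hist_densities d) auto

lemma spiked_factor: "spiked a v = (\<lambda>x. base x * hist d (\<lambda>k. 1 + a * spike v k) x)"
  by (auto simp: spiked_def base_def hist_def)

lemma base_nonneg: "0 \<le> base x"
  using c0_nonneg by (simp add: base_def hist_def)

lemma sample_law_spiked:
  assumes v: "v \<in> params" and a: "0 \<le> a" "a \<le> 1"
  shows "sample_law n (spiked a v) = density (sample_law n base) (\<lambda>X. ennreal (likelihood a v X))"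
  unfolding likelihood_def
proof (subst spiked_factor, rule sample_law_likelihood)
  show "prob_space (density lborel (\<lambda>x. ennreal (base x * hist d (\<lambda>k. 1 + a * spike v k) x)))"
    using prob_space_density_lborel[OF spiked_density[OF v a]] by (simp only: spiked_factor)
  show "0 \<le> hist d (\<lambda>k. 1 + a * spike v k) x" for x
    using amplitude_nonneg[OF a] by (simp add: hist_def)
  show "base \<in> borel_measurable borel" using d by (simp add: base_def hist_borel)
qed (use prob_space_density_lborel[OF base_density] base_nonneg d in \<open>auto simp: hist_borel\<close>)

lemma likelihood_nonneg:
  assumes "0 \<le> a" "a \<le> 1"
  shows "0 \<le> likelihood a v X"
  unfolding likelihood_def using amplitude_nonneg[OF assms]
  by (intro prod_nonneg) (simp add: hist_def)

lemma base_hist_integral: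
  shows "has_bochner_integral (density lborel (\<lambda>x. ennreal (base x))) (hist d f) ((\<Sum>k<d. c0 k * f k) / real d)"
proof -
  have "has_bochner_integral lborel (\<lambda>x. base x * hist d f x) ((\<Sum>k<d. c0 k * f k) / real d)"
  proof -
    have "(\<lambda>x. base x * hist d f x) = hist d (\<lambda>k. c0 k * f k)" by (auto simp: base_def hist_def)
    thus ?thesis using hist_integral[OF d] by simp
  qed
  moreover have "base \<in> borel_measurable lborel" using d by (simp add: base_def hist_borel)
  ultimately show ?thesis using base_nonneg d hist_borel[OF d]
    by (intro has_bochner_integral_density) auto
qed

lemma likelihood_overlap:
  assumes v: "v \<in> params" and w: "w \<in> params"
  shows "has_bochner_integral (sample_law n base) (\<lambda>X. likelihood a v X * likelihood a w X)
    ((1 + a\<^sup>2 * h / real d * agreement v w) ^ n)"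
proof -
  let ?f = "\<lambda>k. (1 + a * spike v k) * (1 + a * spike w k)"
  have "(\<Sum>k<d. c0 k * (?f k - 1)) = (\<Sum>k<D * g. c0 k * (?f k - 1))"
    by (intro sum_spiked_bins) (simp add: spike_def)
  also have "\<dots> = (\<Sum>k<D * g. h * (a * spike v k + a * spike w k + a\<^sup>2 * (spike v k * spike w k)))"
    by (intro sum.cong) (auto simp: c0_eq power2_eq_square algebra_simps)
  also have "\<dots> = h * a\<^sup>2 * agreement v w"
    using spike_sum[OF v] spike_sum[OF w] spike_inner[OF v w]
    by (simp add: sum.distrib sum_distrib_left[symmetric])
  finally have "(\<Sum>k<d. c0 k * ?f k) = real d + h * a\<^sup>2 * agreement v w"
    using c0_total by (simp add: right_diff_distrib sum_subtractf)
  hence eq: "(\<Sum>k<d. c0 k * ?f k) / real d = 1 + a\<^sup>2 * h / real d * agreement v w"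
    using d by (simp add: field_simps)
  have "has_bochner_integral (sample_law n base) (\<lambda>X. \<Prod>i<n. hist d ?f (X i))
    ((1 + a\<^sup>2 * h / real d * agreement v w) ^ n)"
    using likelihood_product_moment[OF prob_space_density_lborel[OF base_density], of "hist d ?f" n]
      base_hist_integral[of ?f] eq
    by (simp add: sample_law_def has_bochner_integral_iff)
  moreover have "(\<lambda>X. \<Prod>i<n. hist d ?f (X i)) = (\<lambda>X. likelihood a v X * likelihood a w X)"
    unfolding likelihood_def prod.distrib[symmetric] by (intro ext prod.cong) (auto simp: hist_def)
  ultimately show ?thesis by simp
qed

lemma likelihood_measurable: "likelihood a v \<in> borel_measurable (sample_law n base)"
proof -
  have [measurable]: "hist d (\<lambda>k. 1 + a * spike v k) \<in> borel_measurable borel"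
    using d by (rule hist_borel)
  show ?thesis unfolding likelihood_def sample_law_def by measurable
qed

lemma measure_spiked:
  assumes v: "v \<in> params" and a: "0 \<le> a" "a \<le> 1" and A: "A \<in> sets (sample_space n)"
  shows "measure (sample_law n (spiked a v)) A =
    (LINT X|sample_law n base. likelihood a v X * indicator A X)"
proof -
  have A': "A \<in> sets (sample_law n base)" using A by (simp add: sets_sample_law)
  have "measure (sample_law n (spiked a v)) A = (LINT X|sample_law n (spiked a v). indicator A X)"
    using A sets.sets_into_space[OF A] by (simp add: sets_sample_law space_sample_law Int_absorb2)
  also have "\<dots> = (LINT X|sample_law n base. likelihood a v X * indicator A X)"
    unfolding sample_law_spiked[OF v a]
    using A' likelihood_measurable likelihood_nonneg[OF a] by (subst integral_density) auto
  finally show ?thesis .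
qed

text \<open>The likelihood has mean 1 because the density with spikes is a probability density.\<close>

lemma likelihood_integral:
  assumes v: "v \<in> params" and a: "0 \<le> a" "a \<le> 1"
  shows "has_bochner_integral (sample_law n base) (likelihood a v) 1"
proof -
  interpret s: prob_space "sample_law n (spiked a v)"
    using prob_space_sample_law[OF spiked_density[OF v a]] .
  let ?Q = "sample_law n base" and ?S = "space (sample_law n base)"
  have Q: "likelihood a v X = likelihood a v X * indicator ?S X" if "X \<in> ?S" for X
    using that by simp
  have S: "measure (sample_law n (spiked a v)) ?S = 1"
    using s.prob_space by (simp add: space_sample_law)
  have "(LINT X|?Q. likelihood a v X) = (LINT X|?Q. likelihood a v X * indicator ?S X)"
    using Q by (intro Bochner_Integration.integral_cong) auto
  also have "\<dots> = 1"
    using measure_spiked[OF v a, of ?S] S by (simp add: space_sample_law)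
  finally have one: "(LINT X|?Q. likelihood a v X) = 1" .
  hence "integrable ?Q (likelihood a v)"
    using not_integrable_integral_eq by fastforce
  thus ?thesis using one by (simp add: has_bochner_integral_iff)
qed

lemma l2dist_spiked:
  assumes v: "v \<in> params" and w: "w \<in> params"
  shows "(l2dist (spiked a v) (spiked b w))\<^sup>2 =
    h\<^sup>2 / real d * (a\<^sup>2 * agreement v v + b\<^sup>2 * agreement w w - 2 * a * b * agreement v w)"
proof -
  have "(\<Sum>k<d. (c0 k * (1 + a * spike v k) - c0 k * (1 + b * spike w k))\<^sup>2) =
      (\<Sum>k<D * g. (c0 k * (1 + a * spike v k) - c0 k * (1 + b * spike w k))\<^sup>2)"
    by (intro sum_spiked_bins) (simp add: spike_def)
  also have "\<dots> = (\<Sum>k<D * g. h\<^sup>2 * (a\<^sup>2 * (spike v k * spike v k) + b\<^sup>2 * (spike w k * spike w k)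
      - 2 * a * b * (spike v k * spike w k)))"
    by (intro sum.cong) (auto simp: c0_eq power2_eq_square algebra_simps)
  also have "\<dots> = h\<^sup>2 * (a\<^sup>2 * agreement v v + b\<^sup>2 * agreement w w - 2 * a * b * agreement v w)"
    using v w by (simp add: sum.distrib sum_subtractf sum_distrib_left[symmetric] spike_inner)
  finally show ?thesis
    by (simp add: spiked_def l2dist_hist[OF d])
qed

lemma agreement_self: "agreement v v = real D * real g * (real g - 1)"
  by (simp add: agreement_def)

lemma l2dist_spiked_base:
  assumes v: "v \<in> params"
  shows "(l2dist (spiked a v) base)\<^sup>2 = a\<^sup>2 * h\<^sup>2 * (real D * real g * (real g - 1) / real d)"
  using l2dist_spiked[OF v v, of a 0] by (simp add: spiked_zero agreement_self)

end

section \<open>Overlaps and clusters of spike positions\<close>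

text \<open>For negative \<open>y\<close> this follows from the quadratic Taylor bound for \<open>exp (- y)\<close> from below.\<close>

lemma exp_le_quadratic:
  assumes "y \<le> (1::real)"
  shows "exp y \<le> 1 + y + y\<^sup>2"
proof (cases "0 \<le> y")
  case True
  thus ?thesis using assms by (rule exp_bound)
next
  case False
  define z where "z = - y"
  have z: "0 \<le> z" using False by (simp add: z_def)
  have "(1 + z + z\<^sup>2 / 2) * (1 - z + z\<^sup>2) = 1 + (z ^ 2 + z ^ 3 + z ^ 4) / 2"
    by (simp add: power2_eq_square power3_eq_cube power4_eq_xxxx field_simps)
  hence one: "1 \<le> (1 + z + z\<^sup>2 / 2) * (1 - z + z\<^sup>2)" using z by simp
  have "0 \<le> 1 - z + z\<^sup>2"
  proof -
    have "0 \<le> (z - 1)\<^sup>2" by simp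
    thus ?thesis using z by (simp add: power2_diff)
  qed
  hence "(1 + z + z\<^sup>2 / 2) * (1 - z + z\<^sup>2) \<le> exp z * (1 - z + z\<^sup>2)"
    using exp_lower_Taylor_quadratic[OF z] by (intro mult_right_mono) auto
  with one have "1 \<le> exp z * (1 - z + z\<^sup>2)" by linarith
  hence "exp y * 1 \<le> exp y * (exp z * (1 - z + z\<^sup>2))" by (intro mult_left_mono) auto
  also have "\<dots> = 1 - z + z\<^sup>2"
    by (simp add: z_def mult.assoc[symmetric] exp_add[symmetric])
  finally show ?thesis by (simp add: z_def)
qed

context spikes
begin

text \<open>Here \<open>\<chi>\<^sup>2\<close>-closeness of the mixture is decided. Bounding \<open>(1 + x) ^ n\<close> by \<open>exp (n * x)\<close> makes
  the overlap a product over the groups, and the average over the positions of the second spike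
  factorizes. In each factor the linear term cancels, since a spike has mean 0; only the
  quadratic term \<open>t\<^sup>2 * g\<close> is left, where \<open>t * (g - 1)\<close> is the exponent that a single agreeing
  group contributes. This cancellation is the reason for the rate \<open>sqrt d / n\<close> instead of \<open>d / n\<close>.\<close>

lemma mean_overlap_le:
  assumes b: "0 \<le> b" "b \<le> 1"
    and t_def: "t = real n * b\<^sup>2 * h * real g / real d" and tg: "t * real g \<le> 1"
    and small: "real D * t\<^sup>2 * real g \<le> \<eta>\<^sup>2 / 2" and \<eta>: "\<eta> \<le> 1" "0 \<le> \<eta>"
  shows "(\<Sum>v\<in>params. \<Sum>w\<in>params. (1 + b\<^sup>2 * h / real d * agreement v w) ^ n)
    \<le> (1 + \<eta>\<^sup>2) * (real (card params))\<^sup>2"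
proof -
  have t: "0 \<le> t" using h_nonneg by (simp add: t_def)
  have "h * real (D * g) \<le> real d"
  proof -
    have "h * real (D * g) = (\<Sum>k<D * g. c0 k)" by (simp add: c0_eq)
    also have "\<dots> \<le> (\<Sum>k<d. c0 k)" using Dg c0_nonneg by (intro sum_mono2) auto
    finally show ?thesis using c0_total by simp
  qed
  hence hDg: "h / real d * (real D * real g) \<le> 1" using d by (simp add: field_simps)
  have power_le: "(1 + b\<^sup>2 * h / real d * agreement v w) ^ n
      \<le> (\<Prod>j<D. exp (t * (real g * of_bool (v j = w j) - 1)))" for v w
  proof -
    define x where "x = b\<^sup>2 * h / real d * agreement v w"
    have "- (real D * real g) = (\<Sum>j<D. real g * (0 - 1))" by simp
    also have "\<dots> \<le> agreement v w"
      unfolding agreement_def by (intro sum_mono mult_left_mono) auto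
    finally have "b\<^sup>2 * h / real d * - (real D * real g) \<le> x"
      unfolding x_def using h_nonneg by (intro mult_left_mono) auto
    moreover have "b\<^sup>2 * (h / real d * (real D * real g)) \<le> 1 * 1"
      using hDg b h_nonneg by (intro mult_mono power_le_one) auto
    ultimately have "0 \<le> 1 + x" by simp
    hence "(1 + x) ^ n \<le> exp x ^ n" by (intro power_mono exp_ge_add_one_self)
    also have "\<dots> = exp (real n * x)" by (simp add: exp_of_nat_mult)
    also have "real n * x = (\<Sum>j<D. t * (real g * of_bool (v j = w j) - 1))"
      by (simp add: x_def agreement_def t_def sum_distrib_left mult_ac)
    finally show ?thesis by (simp add: x_def exp_sum)
  qed
  have "(\<Sum>w\<in>params. (1 + b\<^sup>2 * h / real d * agreement v w) ^ n) \<le> (1 + \<eta>\<^sup>2) * real (card params)"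
    if v: "v \<in> params" for v
  proof -
    have factor: "(\<Sum>i<g. exp (t * (real g * of_bool (v j = i) - 1))) \<le> real g * (1 + t\<^sup>2 * real g)"
      if "j < D" for j
    proof -
      have vj: "v j < g" using params_less[OF v that] .
      have "(\<Sum>i<g. exp (t * (real g * of_bool (v j = i) - 1)))
          \<le> (\<Sum>i<g. 1 + t * (real g * of_bool (v j = i) - 1) + (t * (real g * of_bool (v j = i) - 1))\<^sup>2)"
      proof (intro sum_mono exp_le_quadratic)
        fix i
        have "t * (real g * of_bool (v j = i) - 1) \<le> t * real g"
          using t by (intro mult_left_mono) (auto simp: of_bool_def)
        thus "t * (real g * of_bool (v j = i) - 1) \<le> 1" using tg by simp
      qed
      also have "\<dots> = (\<Sum>i<g. (1 - t + t\<^sup>2) + (t * real g + t\<^sup>2 * (real g)\<^sup>2 - 2 * t\<^sup>2 * real g) * of_bool (v j = i))"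
        by (intro sum.cong) (auto simp: of_bool_def power2_eq_square algebra_simps)
      also have "\<dots> = real g * (1 + t\<^sup>2 * (real g - 1))"
      proof -
        have lin: "(\<Sum>i<g. A + B * of_bool (v j = i)) = real g * A + B" for A B
          using vj by (simp add: sum.distrib sum_distrib_left[symmetric] of_bool_def)
        thus ?thesis by (subst lin) (simp add: power2_eq_square algebra_simps)
      qed
      also have "\<dots> \<le> real g * (1 + t\<^sup>2 * real g)"
        by (intro mult_left_mono add_left_mono) auto
      finally show ?thesis .
    qed
    have "(\<Sum>w\<in>params. (1 + b\<^sup>2 * h / real d * agreement v w) ^ n)
        \<le> (\<Sum>w\<in>params. \<Prod>j<D. exp (t * (real g * of_bool (v j = w j) - 1)))"
      by (intro sum_mono power_le)
    also have "\<dots> = (\<Prod>j<D. \<Sum>i<g. exp (t * (real g * of_bool (v j = i) - 1)))"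
      unfolding params_def by (rule prod_sum_PiE[symmetric]) auto
    also have "\<dots> \<le> (\<Prod>j<D. real g * (1 + t\<^sup>2 * real g))"
      using factor by (intro prod_mono) (auto intro: sum_nonneg)
    also have "\<dots> = real (card params) * (1 + t\<^sup>2 * real g) ^ D"
      by (simp add: params_card power_mult_distrib)
    also have "\<dots> \<le> real (card params) * exp (t\<^sup>2 * real g) ^ D"
      using exp_ge_add_one_self by (intro mult_left_mono power_mono) auto
    also have "\<dots> = real (card params) * exp (real D * t\<^sup>2 * real g)"
      by (simp add: exp_of_nat_mult[symmetric] mult_ac)
    also have "\<dots> \<le> real (card params) * exp (\<eta>\<^sup>2 / 2)"
      using small by (intro mult_left_mono) auto
    also have "exp (\<eta>\<^sup>2 / 2) \<le> 1 + \<eta>\<^sup>2"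
    proof -
      define z where "z = \<eta>\<^sup>2 / 2"
      have "\<eta>\<^sup>2 \<le> 1" using \<eta> by (simp add: power_le_one)
      hence z: "z \<le> 1" "0 \<le> z" by (simp_all add: z_def)
      hence "exp z \<le> 1 + z + z\<^sup>2" by (intro exp_le_quadratic)
      also have "z\<^sup>2 \<le> z * 1" unfolding power2_eq_square using z by (intro mult_left_mono)
      finally show ?thesis by (simp add: z_def)
    qed
    finally show ?thesis by (simp add: mult_left_mono mult.commute[of "1 + \<eta>\<^sup>2"])
  qed
  hence "(\<Sum>v\<in>params. \<Sum>w\<in>params. (1 + b\<^sup>2 * h / real d * agreement v w) ^ n)
      \<le> (\<Sum>v\<in>params. (1 + \<eta>\<^sup>2) * real (card params))"
    by (intro sum_mono)
  thus ?thesis by (simp add: power2_eq_square mult_ac)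
qed

text \<open>A set of binary words with mutual Hamming distances at most \<open>D / 8\<close> lies in a Hamming ball,
  whose size is bounded by Chernoff's method: each word \<open>w\<close> is weighted by \<open>(1/4)\<close> to
  the power of its distance to the centre. The constants fit because \<open>4 \<le> (6/5) ^ 8\<close> and
  \<open>6/5 * (1 + 1/4) = 3/2\<close>.\<close>

lemma card_hamming_cluster_le:
  assumes g2: "g = 2" and V: "V \<subseteq> params"
    and near: "\<And>v w. v \<in> V \<Longrightarrow> w \<in> V \<Longrightarrow> 8 * card {j. j < D \<and> v j \<noteq> w j} \<le> D"
  shows "real (card V) \<le> (3/2) ^ D"
proof (cases "V = {}")
  case False
  then obtain u where u: "u \<in> V" by auto
  define p where "p = (\<lambda>w. \<Prod>j<D. if u j = w j then 1 else 1/4 :: real)"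
  have one: "1 \<le> (6/5) ^ D * p w" if w: "w \<in> V" for w
  proof -
    define m where "m = card {j. j < D \<and> u j \<noteq> w j}"
    have "p w = (1/4) ^ m"
      unfolding p_def m_def by (subst prod.If_cases) (auto simp: Int_def Collect_neg_eq[symmetric])
    hence "1 = 4 ^ m * p w" by (simp add: power_mult_distrib[symmetric])
    also have "\<dots> \<le> (6/5) ^ D * p w"
    proof (rule mult_right_mono)
      have "(4::real) ^ m \<le> ((6/5) ^ 8) ^ m" by (intro power_mono) (auto simp: power_divide)
      also have "\<dots> = (6/5) ^ (8 * m)" by (simp only: power_mult)
      also have "\<dots> \<le> (6/5 :: real) ^ D" using near[OF u w] by (intro power_increasing) (auto simp: m_def)
      finally show "(4::real) ^ m \<le> (6/5) ^ D" .
    qed (auto simp: p_def intro!: prod_nonneg)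
    finally show ?thesis .
  qed
  have "real (card V) = (\<Sum>w\<in>V. 1)" by simp
  also have "\<dots> \<le> (\<Sum>w\<in>V. (6/5) ^ D * p w)" using one by (intro sum_mono)
  also have "\<dots> \<le> (\<Sum>w\<in>params. (6/5) ^ D * p w)"
    using V params_finite by (intro sum_mono2) (auto simp: p_def intro!: mult_nonneg_nonneg prod_nonneg)
  also have "\<dots> = (6/5) ^ D * (\<Prod>j<D. \<Sum>i<g. if u j = i then 1 else 1/4)"
    unfolding p_def sum_distrib_left[symmetric] params_def by (subst prod_sum_PiE) auto
  also have "(\<Prod>j<D. \<Sum>i<g. if u j = i then 1 else 1/4) = (\<Prod>j<D. 5/4 :: real)"
  proof (rule prod.cong[OF refl])
    fix j assume "j \<in> {..<D}"
    hence "u j < 2" using params_less u V g2 by (metis lessThan_iff subsetD)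
    thus "(\<Sum>i<g. if u j = i then 1 else 1/4) = (5/4 :: real)"
      unfolding g2 by (auto simp: numeral_2_eq_2 less_Suc_eq)
  qed
  also have "(6/5 :: real) ^ D * (\<Prod>j<D. 5/4) = (3/2) ^ D"
    by (simp add: power_mult_distrib[symmetric])
  finally show ?thesis .
qed simp

lemma agreement_hamming:
  assumes "g = 2"
  shows "agreement v w = 2 * real D - 4 * real (card {j. j < D \<and> v j \<noteq> w j})"
proof -
  have "agreement v w = (\<Sum>j<D. 2 - 4 * of_bool (v j \<noteq> w j))"
    unfolding agreement_def by (intro sum.cong) (auto simp: assms)
  also have "\<dots> = 2 * real D - 4 * (\<Sum>j<D. of_bool (v j \<noteq> w j))"
    by (simp add: sum_subtractf sum_distrib_left[symmetric])
  also have "(\<Sum>j<D. of_bool (v j \<noteq> w j)) = real (card {j. j < D \<and> v j \<noteq> w j})"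
    by (simp add: of_bool_def sum.If_cases Int_def)
  finally show ?thesis .
qed

end

section \<open>Confidence sets against densities with spikes\<close>

text \<open>The only properties of a confidence ball that the lower bounds use: \<open>C s\<close> is the event
  that it contains \<open>s\<close>, and \<open>G\<close> the event that its diameter exceeds \<open>\<delta>\<close>.\<close>

locale confidence_events =
  fixes n :: nat and T :: "(real \<Rightarrow> real) set"
    and C :: "(real \<Rightarrow> real) \<Rightarrow> (nat \<Rightarrow> real) set" and G :: "(nat \<Rightarrow> real) set" and \<beta> \<delta> :: real
  assumes C_sets: "\<And>s. s \<in> T \<Longrightarrow> C s \<in> sets (sample_space n)"
    and coverage: "\<And>s. s \<in> T \<Longrightarrow> 1 - \<beta> \<le> measure (sample_law n s) (C s)"
    and G_sets: "G \<in> sets (sample_space n)"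
    and close: "\<And>s t X. s \<in> T \<Longrightarrow> t \<in> T \<Longrightarrow> X \<in> C s \<Longrightarrow> X \<in> C t \<Longrightarrow> X \<notin> G \<Longrightarrow> l2dist s t \<le> \<delta>"

locale spiked_confidence =
  spikes n d g D h c0 + confidence_events n "densities (histograms d)" C G \<beta> \<delta>
  for n d g D h c0 C G \<beta> \<delta>
begin

lemma covered_outside:
  assumes s: "s \<in> densities (histograms d)" and A: "A \<in> sets (sample_space n)" "C s - G \<subseteq> A"
  shows "1 - \<beta> - measure (sample_law n s) G \<le> measure (sample_law n s) A"
proof -
  interpret prob_space "sample_law n s" using s by (rule prob_space_sample_law)
  have "prob (C s) \<le> prob (A \<union> G)"
    using A G_sets by (intro finite_measure_mono) (auto simp: sets_sample_law)
  also have "\<dots> \<le> prob A + prob G"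
    using A G_sets by (intro measure_Un_le) (auto simp: sets_sample_law)
  finally show ?thesis using coverage[OF s] by simp
qed

text \<open>The \<open>K\<close> amplitudes \<open>a * k / K\<close> give densities whose distances to the base are multiples of
  one step, which exceeds \<open>\<delta>\<close>; so a small ball meets at most one amplitude. Closeness of the mixture is
  used twice: for \<open>G\<close>, whose probability is bounded under the base law only, and for
  the event \<open>E k\<close>; hence the loss \<open>2 * \<eta>\<close>.\<close>

lemma detection_bound:
  assumes \<eta>: "\<eta> > 0" and K: "K > (0::nat)" and a: "0 \<le> a" "a \<le> 1"
    and overlap: "\<And>b. 0 \<le> b \<Longrightarrow> b \<le> a \<Longrightarrow>
      (\<Sum>v\<in>params. \<Sum>w\<in>params. (1 + b\<^sup>2 * h / real d * agreement v w) ^ n)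
        \<le> (1 + \<eta>\<^sup>2) * (real (card params))\<^sup>2"
    and G: "measure (sample_law n base) G \<le> \<alpha>"
    and \<delta>: "real K * \<delta> < a * h * sqrt (real D * real g * (real g - 1) / real d)"
  shows "real K * (1 - \<alpha> - \<beta> - 2 * \<eta>) \<le> 1"
proof -
  interpret Q: prob_space "sample_law n base" using base_density by (rule prob_space_sample_law)
  define r where "r = h * sqrt (real D * real g * (real g - 1) / real d)"
  have r: "0 \<le> r" using h_nonneg g by (simp add: r_def)
  have dist_base: "l2dist (spiked b v) base = b * r" if "v \<in> params" "0 \<le> b" for b v
  proof -
    have "(b * r)\<^sup>2 = (l2dist (spiked b v) base)\<^sup>2"
      using l2dist_spiked_base[OF that(1), of b] g by (simp add: r_def power_mult_distrib)
    thus ?thesis using r that by (simp add: power2_eq_iff_nonneg)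
  qed
  define b where "b = (\<lambda>k::nat. a * (real k / real K))"
  have b: "0 \<le> b k" "b k \<le> a" "b k \<le> 1" if "k \<in> {1..K}" for k
  proof -
    have "real k / real K \<le> 1" using that K by simp
    hence "a * (real k / real K) \<le> a * 1" using a by (intro mult_left_mono) auto
    thus "b k \<le> a" "b k \<le> 1" using a by (auto simp: b_def)
    show "0 \<le> b k" using a by (simp add: b_def)
  qed
  have dens: "spiked (b k) v \<in> densities (histograms d)" if "k \<in> {1..K}" "v \<in> params" for k v
    using spiked_density that b by auto
  have L2: "s \<in> L2_functions" if "s \<in> densities (histograms d)" for s
    using that histograms_L2[OF d] by (auto simp: densities_def)
  define E where "E = (\<lambda>k. (\<Union>v\<in>params. C (spiked (b k) v)) - G)"
  have E_sets: "E k \<in> sets (sample_space n)" if "k \<in> {1..K}" for k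
    unfolding E_def using G_sets params_finite C_sets dens[OF that] by (intro sets.Diff sets.finite_UN) auto
  have lower: "1 - \<alpha> - \<beta> - 2 * \<eta> \<le> Q.prob (E k)" if k: "k \<in> {1..K}" for k
  proof -
    define N where "N = real (card params)"
    have N: "N > 0" using params_finite params_nonempty by (simp add: N_def card_gt_0_iff)
    have mixture: "(\<Sum>v\<in>params. measure (sample_law n (spiked (b k) v)) A) / N \<le> Q.prob A + \<eta>"
      if A: "A \<in> sets (sample_space n)" for A
    proof -
      have "(\<Sum>v\<in>params. LINT X|sample_law n base. likelihood (b k) v X * indicator A X) / N \<le> Q.prob A + \<eta>"
        unfolding N_def
        using params_finite params_nonempty \<eta> A likelihood_integral likelihood_overlap overlap b[OF k]
        by (intro Q.mixture_prob_le[where c = "\<lambda>v w. (1 + (b k)\<^sup>2 * h / real d * agreement v w) ^ n"])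
          (auto simp: sets_sample_law)
      thus ?thesis using measure_spiked b[OF k] A by simp
    qed
    have "(\<Sum>v\<in>params. 1 - \<beta> - measure (sample_law n (spiked (b k) v)) G)
        \<le> (\<Sum>v\<in>params. measure (sample_law n (spiked (b k) v)) (E k))"
      using dens[OF k] E_sets[OF k] by (intro sum_mono covered_outside) (auto simp: E_def)
    hence "(1 - \<beta>) * N - (\<Sum>v\<in>params. measure (sample_law n (spiked (b k) v)) G)
        \<le> (\<Sum>v\<in>params. measure (sample_law n (spiked (b k) v)) (E k))"
      by (simp add: sum_subtractf N_def mult.commute)
    also have "\<dots> \<le> (Q.prob (E k) + \<eta>) * N"
      using mixture[OF E_sets[OF k]] N by (simp add: field_simps)
    finally have "(1 - \<beta>) * N \<le> (Q.prob (E k) + \<eta>) * N + (\<Sum>v\<in>params. measure (sample_law n (spiked (b k) v)) G)"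
      by simp
    also have "\<dots> \<le> (Q.prob (E k) + \<eta>) * N + (Q.prob G + \<eta>) * N"
      using mixture[OF G_sets] N by (simp add: field_simps)
    finally have "(1 - \<beta>) * N \<le> (Q.prob (E k) + \<eta> + (Q.prob G + \<eta>)) * N" by (simp add: algebra_simps)
    hence "1 - \<beta> \<le> Q.prob (E k) + \<eta> + (Q.prob G + \<eta>)" using N by simp
    thus ?thesis using G by simp
  qed
  have disjoint: "disjoint_family_on E {1..K}"
  unfolding disjoint_family_on_def
  proof (intro ballI impI, rule ccontr)
    fix k l assume k: "k \<in> {1..K}" and l: "l \<in> {1..K}" and "k \<noteq> l" "E k \<inter> E l \<noteq> {}"
    then obtain X v w where X: "v \<in> params" "w \<in> params" "X \<in> C (spiked (b k) v)" "X \<in> C (spiked (b l) w)" "X \<notin> G"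
      by (auto simp: E_def)
    have near: "l2dist (spiked (b k) v) (spiked (b l) w) \<le> \<delta>"
      using X k l dens by (intro close) auto
    have "\<bar>b k * r - b l * r\<bar> \<le> l2dist (spiked (b k) v) (spiked (b l) w)"
      using l2dist_triangle[OF L2 L2 L2, OF dens[OF k X(1)] dens[OF l X(2)] base_density]
        l2dist_triangle[OF L2 L2 L2, OF dens[OF l X(2)] dens[OF k X(1)] base_density]
        dist_base[OF X(1), of "b k"] dist_base[OF X(2), of "b l"] b[OF k] b[OF l]
      by (auto simp: l2dist_commute)
    with near have "\<bar>b k * r - b l * r\<bar> \<le> \<delta>" by simp
    hence "real K * \<bar>b k * r - b l * r\<bar> \<le> real K * \<delta>" by (intro mult_left_mono) auto
    also have "real K * \<bar>b k * r - b l * r\<bar> = \<bar>real k - real l\<bar> * (a * r)"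
    proof -
      have "real K * (b k * r - b l * r) = (real k - real l) * (a * r)"
        using K by (simp add: b_def field_simps)
      hence "\<bar>real K * (b k * r - b l * r)\<bar> = \<bar>(real k - real l) * (a * r)\<bar>" by simp
      thus ?thesis using a r by (simp add: abs_mult)
    qed
    finally have "\<bar>real k - real l\<bar> * (a * r) \<le> real K * \<delta>" .
    moreover have "1 * (a * r) \<le> \<bar>real k - real l\<bar> * (a * r)"
      using \<open>k \<noteq> l\<close> a r by (intro mult_right_mono) auto
    ultimately show False using \<delta> by (simp add: r_def mult.assoc)
  qed
  have "real K * (1 - \<alpha> - \<beta> - 2 * \<eta>) = (\<Sum>k\<in>{1..K}. 1 - \<alpha> - \<beta> - 2 * \<eta>)" by simp
  also have "\<dots> \<le> (\<Sum>k\<in>{1..K}. Q.prob (E k))" using lower by (intro sum_mono) auto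
  also have "\<dots> = Q.prob (\<Union>k\<in>{1..K}. E k)"
    using disjoint E_sets by (intro Q.finite_measure_finite_Union[symmetric]) (auto simp: sets_sample_law)
  also have "\<dots> \<le> 1" by (rule Q.prob_le_1)
  finally show ?thesis .
qed

text \<open>When \<open>X \<notin> G\<close>, the patterns whose densities are covered at \<open>X\<close> form a cluster, hence a fraction
  at most \<open>(3/4) ^ D\<close> of all patterns, while the second moment of the likelihood ratios is at most
  \<open>exp (D / 8)\<close>.\<close>

lemma estimation_bound:
  assumes g2: "g = 2" and full: "h * (2 * real D) = real d" and a: "0 \<le> a" "a \<le> 1"
    and na: "8 * (real n * a\<^sup>2) \<le> real D"
    and G: "\<And>v. v \<in> params \<Longrightarrow> measure (sample_law n (spiked a v)) G \<le> \<alpha>"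
    and \<delta>: "\<delta>\<^sup>2 < a\<^sup>2 * h\<^sup>2 * real D / real d"
  shows "1 - \<alpha> - \<beta> \<le> (97/100) ^ D"
proof -
  interpret Q: prob_space "sample_law n base" using base_density by (rule prob_space_sample_law)
  define R where "R = (1 + a\<^sup>2) ^ n"
  \<comment> \<open>The base \<open>17/20\<close> lies between \<open>3/4\<close> and \<open>exp (- 1/8)\<close>, so that both terms of the bound
     decrease exponentially.\<close>
  define \<tau> :: real where "\<tau> = (17/20) ^ D"
  define A where "A = (\<lambda>v. C (spiked a v) - G)"
  define N where "N = real (card params)"
  have "N = real (g ^ D)" unfolding N_def params_card ..
  hence N: "N > 0" "N = 2 ^ D" by (simp_all add: g2)
  have self: "agreement v v = 2 * real D" for v
    unfolding agreement_self by (simp add: g2)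
  have dens: "spiked a v \<in> densities (histograms d)" if "v \<in> params" for v
    using that a by (rule spiked_density)
  have A_sets: "A v \<in> sets (sample_space n)" if "v \<in> params" for v
    unfolding A_def using C_sets[OF dens[OF that]] G_sets by auto
  have second: "has_bochner_integral (sample_law n base) (\<lambda>X. likelihood a v X * likelihood a v X) R"
    if v: "v \<in> params" for v
  proof -
    have "a\<^sup>2 * h / real d * agreement v v = a\<^sup>2 * (h * (2 * real D)) / real d"
      by (simp add: self)
    thus ?thesis using likelihood_overlap[OF v v, of a] full d by (simp add: R_def)
  qed
  have few: "real (card {v \<in> params. X \<in> A v}) \<le> (3/4) ^ D * N" for X
  proof -
    have "real (card {v \<in> params. X \<in> A v}) \<le> (3/2) ^ D"
    proof (rule card_hamming_cluster_le[OF g2])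
      fix v w assume v: "v \<in> {v \<in> params. X \<in> A v}" and w: "w \<in> {v \<in> params. X \<in> A v}"
      define m where "m = real (card {j. j < D \<and> v j \<noteq> w j})"
      have "l2dist (spiked a v) (spiked a w) \<le> \<delta>"
        using v w dens by (intro close[of _ _ X]) (auto simp: A_def)
      hence "(l2dist (spiked a v) (spiked a w))\<^sup>2 \<le> \<delta>\<^sup>2" by (intro power_mono) auto
      also note \<delta>
      finally have less: "(l2dist (spiked a v) (spiked a w))\<^sup>2 < a\<^sup>2 * h\<^sup>2 / real d * real D" by simp
      have "(l2dist (spiked a v) (spiked a w))\<^sup>2 =
          h\<^sup>2 / real d * (a\<^sup>2 * (2 * real D) + a\<^sup>2 * (2 * real D) - 2 * a * a * (2 * real D - 4 * m))"
        using l2dist_spiked[of v w a a] v w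
        by (simp add: agreement_hamming[OF g2, of v w] self m_def)
      also have "\<dots> = a\<^sup>2 * h\<^sup>2 / real d * (8 * m)"
        by (simp add: power2_eq_square algebra_simps)
      finally have "a\<^sup>2 * h\<^sup>2 / real d * (8 * m) < a\<^sup>2 * h\<^sup>2 / real d * real D" using less by simp
      hence "8 * m < real D" by (rule mult_left_less_imp_less) auto
      thus "8 * card {j. j < D \<and> v j \<noteq> w j} \<le> D" by (simp add: m_def)
    qed auto
    also have "\<dots> = (3/4) ^ D * N" by (simp add: N(2) power_mult_distrib[symmetric])
    finally show ?thesis .
  qed
  have "(1 - \<alpha> - \<beta>) * N \<le> (\<Sum>v\<in>params. measure (sample_law n (spiked a v)) (A v))"
  proof -
    have "1 - \<alpha> - \<beta> \<le> measure (sample_law n (spiked a v)) (A v)" if v: "v \<in> params" for v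
      using covered_outside[OF dens[OF v] A_sets[OF v]] G[OF v] by (simp add: A_def)
    hence "(\<Sum>v\<in>params. 1 - \<alpha> - \<beta>) \<le> (\<Sum>v\<in>params. measure (sample_law n (spiked a v)) (A v))"
      by (intro sum_mono)
    thus ?thesis by (simp add: N_def mult.commute)
  qed
  hence "1 - \<alpha> - \<beta> \<le> (\<Sum>v\<in>params. measure (sample_law n (spiked a v)) (A v)) / N"
    using N(1) by (simp add: field_simps)
  also have "\<dots> = (\<Sum>v\<in>params. LINT X|sample_law n base. likelihood a v X * indicator (A v) X) / N"
    using measure_spiked[OF _ a] A_sets by simp
  also have "\<dots> \<le> (\<tau> * R + (3/4) ^ D / \<tau>) / 2"
    unfolding N_def
    using params_finite params_nonempty A_sets likelihood_integral[OF _ a] second few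
    by (intro Q.average_identification_le) (auto simp: sets_sample_law \<tau>_def N_def)
  also have "\<tau> * R \<le> (97/100) ^ D"
  proof -
    have "R \<le> exp (a\<^sup>2) ^ n" unfolding R_def using exp_ge_add_one_self by (intro power_mono) auto
    also have "\<dots> = exp (real n * a\<^sup>2)" by (simp add: exp_of_nat_mult)
    also have "\<dots> \<le> exp (real D * (1/8))" using na by simp
    also have "\<dots> = exp (1/8) ^ D" by (simp only: exp_of_nat_mult)
    also have "\<dots> \<le> (1 + 1/8 + (1/8)\<^sup>2) ^ D" by (intro power_mono exp_le_quadratic) auto
    finally have "\<tau> * R \<le> \<tau> * (1 + 1/8 + (1/8)\<^sup>2) ^ D" by (intro mult_left_mono) (auto simp: \<tau>_def)
    also have "\<dots> = (17/20 * (1 + 1/8 + (1/8)\<^sup>2)) ^ D" unfolding \<tau>_def by (simp only: power_mult_distrib)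
    also have "\<dots> \<le> (97/100) ^ D" by (intro power_mono) (auto simp: power2_eq_square)
    finally show ?thesis .
  qed
  also have "(3/4) ^ D / \<tau> \<le> (97/100) ^ D"
  proof -
    have "(3/4) ^ D / \<tau> = (3/4 / (17/20)) ^ D" unfolding \<tau>_def by (simp only: power_divide)
    also have "\<dots> \<le> (97/100) ^ D" by (intro power_mono) auto
    finally show ?thesis .
  qed
  finally show ?thesis by simp
qed

end

section \<open>The two lower bounds for the diameter\<close>

lemma confidence_events_random_ball:
  assumes d: "d > 0" and \<delta>: "0 \<le> \<delta>"
    and S: "s_hat \<in> measurable (sample_space n) L2_borel"
    and R: "rho_hat \<in> borel_measurable (sample_space n)"
    and cov: "\<And>s. s \<in> densities (histograms d) \<Longrightarrow> 1 - \<beta> \<le> measure (sample_law n s)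
      {X \<in> space (sample_space n). s \<in> random_ball (histograms d) s_hat rho_hat X}"
  shows "confidence_events n (densities (histograms d))
    (\<lambda>s. {X \<in> space (sample_space n). s \<in> random_ball (histograms d) s_hat rho_hat X})
    {X \<in> space (sample_space n). ennreal \<delta> < diam_L2 (random_ball (histograms d) s_hat rho_hat X)} \<beta> \<delta>"
proof
  fix s assume s: "s \<in> densities (histograms d)"
  hence sh: "s \<in> histograms d" by (simp add: densities_def)
  hence "(\<lambda>X. l2dist s (s_hat X)) \<in> borel_measurable (sample_space n)"
    using histograms_L2[OF d] by (intro l2dist_measurable[OF S]) auto
  hence "{X \<in> space (sample_space n). l2dist s (s_hat X) \<le> rho_hat X} \<in> sets (sample_space n)"
    using R by (rule borel_measurable_le)
  thus "{X \<in> space (sample_space n). s \<in> random_ball (histograms d) s_hat rho_hat X} \<in> sets (sample_space n)"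
    using sh by (simp add: random_ball_def)
  show "1 - \<beta> \<le> measure (sample_law n s)
      {X \<in> space (sample_space n). s \<in> random_ball (histograms d) s_hat rho_hat X}"
    by (rule cov[OF s])
next
  show "{X \<in> space (sample_space n). ennreal \<delta> < diam_L2 (random_ball (histograms d) s_hat rho_hat X)}
      \<in> sets (sample_space n)"
    by (rule diam_event_measurable[OF d S R \<delta>])
next
  fix s t X
  assume "X \<in> {X \<in> space (sample_space n). s \<in> random_ball (histograms d) s_hat rho_hat X}"
    "X \<in> {X \<in> space (sample_space n). t \<in> random_ball (histograms d) s_hat rho_hat X}"
    "X \<notin> {X \<in> space (sample_space n). ennreal \<delta> < diam_L2 (random_ball (histograms d) s_hat rho_hat X)}"
  thus "l2dist s t \<le> \<delta>"
    by (auto simp: less_diam_L2_iff[OF \<delta>] not_less)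
qed

lemma confidence_events_subset:
  assumes "confidence_events n T C G \<beta> \<delta>" "T' \<subseteq> T"
  shows "confidence_events n T' C G \<beta> \<delta>"
  using assms unfolding confidence_events_def by (meson subsetD)

text \<open>Spikes on the uniform density. The squared distance to the uniform density is about
  \<open>a\<^sup>2 * g\<close>, which is set to \<open>x = c * sqrt d / n\<close>. The group size \<open>g\<close> is just above \<open>x\<close>: an
  amplitude of at most 1 requires \<open>x \<le> g\<close>, and the bound \<open>t * g \<le> 1\<close> for the overlaps
  forbids much larger groups.\<close>

lemma diameter_ge_sqrt_dimension:
  assumes conf: "confidence_events n (densities (histograms d)) C G \<beta> \<delta>"
    and n: "n \<ge> 1" and d: "d \<ge> 2"
    and \<kappa>: "\<kappa> = 1 - \<alpha> - \<beta>" "0 < \<kappa>" "\<kappa> \<le> 1" and K: "2 < real K * \<kappa>"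
    and G: "measure (sample_law n (hist d (\<lambda>_. 1))) G \<le> \<alpha>"
  shows "\<kappa> / (32 * (real K)\<^sup>2) * (sqrt (real d) / real n) \<le> \<delta>\<^sup>2"
proof (rule ccontr)
  assume "\<not> ?thesis"
  hence small: "\<delta>\<^sup>2 < \<kappa> / (32 * (real K)\<^sup>2) * (sqrt (real d) / real n)" by simp
  have K0: "K > 0" using K by (cases K) auto
  \<comment> \<open>The mixtures will be within \<open>2 * c = \<kappa> / 4\<close> of the uniform law; two such losses leave
     \<open>\<kappa> / 2\<close> of the probability.\<close>
  define c where "c = \<kappa> / 8"
  have c: "0 < c" "c \<le> 1/8" using \<kappa> by (simp_all add: c_def)
  define x where "x = c * sqrt (real d) / real n"
  have x0: "0 < x" using c n d by (simp add: x_def)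
  have sqrt_le: "sqrt (real d) \<le> real d" using d by (intro real_le_lsqrt) (auto simp: power2_eq_square)
  have "x \<le> c * sqrt (real d) / 1" unfolding x_def using c n by (intro divide_left_mono) auto
  also have "\<dots> \<le> 1/8 * sqrt (real d)" unfolding div_by_1 using c(2) by (rule mult_right_mono) simp
  finally have x_le: "x \<le> sqrt (real d) / 8" by simp
  define g where "g = nat \<lfloor>x\<rfloor> + 2"
  define D where "D = d div g"
  have xg: "x \<le> real g" "real g \<le> x + 2" "2 \<le> g" using x0 by (simp_all add: g_def) linarith+
  have g_le: "g \<le> d"
  proof -
    have "x < real d - 1" using x_le sqrt_le d by linarith
    hence "\<lfloor>x\<rfloor> < int d - 1" by (simp add: floor_less_iff)
    thus ?thesis using d by (simp add: g_def)
  qed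
  have D0: "D > 0" using g_le xg(3) by (simp add: D_def div_greater_zero_iff)
  have Dg: "D * g \<le> d" by (simp add: D_def)
  have half: "real d \<le> 2 * (real D * real g)"
  proof -
    have "d < D * g + g" using dividend_less_div_times[of g d] xg(3) by (simp add: D_def)
    also have "\<dots> \<le> 2 * (D * g)" using D0 by simp
    finally show ?thesis by (simp flip: of_nat_mult)
  qed
  interpret spiked_confidence n d g D 1 "\<lambda>_. 1" C G \<beta> \<delta>
  proof (intro spiked_confidence.intro conf)
    show "spikes d g D 1 (\<lambda>_. 1)" by standard (use d xg(3) D0 Dg in auto)
  qed
  define a where "a = sqrt (x / real g)"
  have a2: "a\<^sup>2 = x / real g" using x0 by (simp add: a_def)
  have "x / real g \<le> 1" using xg by simp
  hence a: "0 \<le> a" "a \<le> 1" using x0 by (auto simp: a_def)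
  have dpos: "0 < real d" "0 < sqrt (real d)" using d by auto
  have tmax: "real n * a\<^sup>2 * 1 * real g / real d = c / sqrt (real d)"
  proof -
    have "real n * a\<^sup>2 * 1 * real g / real d = c * (sqrt (real d) / real d)"
      using xg(3) n by (simp add: a2 x_def)
    also have "sqrt (real d) / real d = 1 / sqrt (real d)"
      using dpos by (simp add: divide_simps)
    finally show ?thesis by simp
  qed
  have overlap: "(\<Sum>v\<in>params. \<Sum>w\<in>params. (1 + b\<^sup>2 * 1 / real d * agreement v w) ^ n)
      \<le> (1 + (2 * c)\<^sup>2) * (real (card params))\<^sup>2" if b: "0 \<le> b" "b \<le> a" for b
  proof -
    define t where "t = real n * b\<^sup>2 * 1 * real g / real d"
    have t0: "0 \<le> t" by (simp add: t_def)
    have "t \<le> real n * a\<^sup>2 * 1 * real g / real d"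
      unfolding t_def using b by (intro divide_right_mono mult_right_mono mult_left_mono power_mono) auto
    hence t: "t \<le> c / sqrt (real d)" by (simp only: tmax)
    have "t * real g \<le> c / sqrt (real d) * (sqrt (real d) / 8 + 2)"
      using t t0 xg x_le c by (intro mult_mono) auto
    also have "\<dots> = c / 8 + 2 * c / sqrt (real d)" using dpos by (simp add: field_simps)
    also have "2 * c / sqrt (real d) \<le> 2 * c / 1" using c d by (intro divide_left_mono) auto
    finally have tg: "t * real g \<le> 1" using c by simp
    have "t\<^sup>2 \<le> (c / sqrt (real d))\<^sup>2" using t t0 by (intro power_mono)
    hence "real D * real g * t\<^sup>2 \<le> real d * (c / sqrt (real d))\<^sup>2"
      using Dg by (intro mult_mono) (auto simp flip: of_nat_mult)
    also have "\<dots> = c\<^sup>2" using dpos by (simp add: power_divide)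
    also have "\<dots> \<le> (2 * c)\<^sup>2 / 2" by (simp add: power_mult_distrib)
    finally have "real D * t\<^sup>2 * real g \<le> (2 * c)\<^sup>2 / 2" by (simp add: mult_ac)
    with tg show ?thesis
      using b a c by (intro mean_overlap_le[where t = t]) (auto simp: t_def)
  qed
  have sep: "real K * \<delta> < a * 1 * sqrt (real D * real g * (real g - 1) / real d)"
  proof (rule power2_less_imp_less)
    have "(real K * \<delta>)\<^sup>2 < x / 4"
      using small K0 n by (simp add: x_def c_def power_mult_distrib field_simps)
    also have "x / 4 = x * (1 / 2) * (1 / 2)" by simp
    also have "\<dots> \<le> x * (real D * real g / real d) * ((real g - 1) / real g)"
      using half dpos xg x0 by (intro mult_mono) (auto simp: field_simps)
    also have "\<dots> = (a * 1 * sqrt (real D * real g * (real g - 1) / real d))\<^sup>2"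
    proof -
      have "(a * 1 * sqrt (real D * real g * (real g - 1) / real d))\<^sup>2
          = x / real g * (real D * real g * (real g - 1) / real d)"
        using xg(3) by (simp add: power_mult_distrib a2)
      thus ?thesis by simp
    qed
    finally show "(real K * \<delta>)\<^sup>2 < (a * 1 * sqrt (real D * real g * (real g - 1) / real d))\<^sup>2" .
    show "0 \<le> a * 1 * sqrt (real D * real g * (real g - 1) / real d)"
      using a xg by simp
  qed
  have "real K * (1 - \<alpha> - \<beta> - 2 * (2 * c)) \<le> 1"
    using c K0 a overlap G sep by (intro detection_bound) (auto simp: base_def)
  moreover have half_margin: "1 - \<alpha> - \<beta> - 2 * (2 * c) = \<kappa> / 2"
    using \<kappa>(1) unfolding c_def by linarith
  ultimately have "real K * (\<kappa> / 2) \<le> 1" by (simp only: half_margin)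
  thus False using K by simp
qed

text \<open>Sign patterns on a base density with \<open>2 * D\<close> bins of height \<open>h = d / (2 * D)\<close>. Their
  squared distances are of order \<open>a\<^sup>2 * h\<^sup>2 * D / d\<close>, and \<open>a\<^sup>2 = D / (M * n)\<close> turns this into a
  multiple of \<open>d / n\<close> for every \<open>D\<close>. The choice of \<open>D\<close> only has to ensure \<open>2 * D \<le> d\<close>,
  \<open>a \<le> 1\<close>, and that \<open>D\<close> is at least \<open>M\<close>.\<close>

lemma diameter_ge_dimension:
  assumes conf: "confidence_events n (densities (histograms d)) C G \<beta> \<delta>"
    and n: "n \<ge> 1" and M: "M \<ge> 8" and d: "d \<ge> 2 * M"
    and \<kappa>: "(97/100) ^ M < 1 - \<alpha> - \<beta>"
    and G: "\<And>s. s \<in> densities (histograms d) \<Longrightarrow> measure (sample_law n s) G \<le> \<alpha>"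
  shows "real d / (4 * real M * real n) \<le> \<delta>\<^sup>2"
proof (rule ccontr)
  assume "\<not> ?thesis"
  hence small: "\<delta>\<^sup>2 < real d / (4 * real M * real n)" by simp
  define D where "D = min (d div 2) (M * n)"
  have "M * 1 \<le> M * n" using n by (intro mult_left_mono) auto
  hence DM: "M \<le> D" using d by (auto simp: D_def)
  hence D0: "D > 0" using M by simp
  have D_le: "D * 2 \<le> d" "D \<le> M * n" by (auto simp: D_def)
  define h where "h = real d / (2 * real D)"
  define c0 where "c0 = (\<lambda>k. if k < D * 2 then h else 0)"
  have "(\<Sum>k<d. c0 k) = (\<Sum>k<D * 2. c0 k)"
    using D_le by (intro sum.mono_neutral_right) (auto simp: c0_def)
  also have "\<dots> = real d" using D0 by (simp add: c0_def h_def)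
  finally have total: "(\<Sum>k<d. c0 k) = real d" .
  interpret spiked_confidence n d 2 D h c0 C G \<beta> \<delta>
  proof (intro spiked_confidence.intro conf)
    show "spikes d 2 D h c0"
      by standard (use D0 D_le d M total in \<open>auto simp: c0_def h_def\<close>)
  qed
  define a where "a = sqrt (real D / (real M * real n))"
  have a2: "a\<^sup>2 = real D / (real M * real n)" by (simp add: a_def)
  have "real D \<le> real M * real n" using D_le(2) by (metis of_nat_le_iff of_nat_mult)
  hence "real D / (real M * real n) \<le> 1" using M n by simp
  hence a: "0 \<le> a" "a \<le> 1" by (auto simp: a_def)
  have "1 - \<alpha> - \<beta> \<le> (97/100) ^ D"
  proof (rule estimation_bound[where a = a])
    show "h * (2 * real D) = real d" using D0 by (simp add: h_def)
    have "8 * (real n * a\<^sup>2) = 8 / real M * real D" using n by (simp add: a2)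
    also have "\<dots> \<le> 1 * real D" using M by (intro mult_right_mono) auto
    finally show "8 * (real n * a\<^sup>2) \<le> real D" by simp
    show "measure (sample_law n (spiked a v)) G \<le> \<alpha>" if "v \<in> params" for v
      using spiked_density[OF that a] by (rule G)
    have "a\<^sup>2 * h\<^sup>2 * real D / real d = real d / (4 * real M * real n)"
    proof -
      have "a\<^sup>2 * h\<^sup>2 * real D / real d =
          real D / (real M * real n) * (real d / (2 * real D))\<^sup>2 * real D / real d"
        by (simp only: a2 h_def)
      also have "\<dots> = real d / (4 * real M * real n)"
        using D0 M n d by (simp add: power2_eq_square field_simps)
      finally show ?thesis .
    qed
    thus "\<delta>\<^sup>2 < a\<^sup>2 * h\<^sup>2 * real D / real d" using small by simp
  qed (use a in auto)
  also have "\<dots> \<le> (97/100) ^ M" using DM by (intro power_decreasing) auto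
  finally show False using \<kappa> by simp
qed

text \<open>For \<open>dm < 2 * M\<close> the term \<open>dm / n\<close> is at most \<open>2 * M * sqrt dn / n\<close>, so only
  large \<open>dm\<close> need the second bound.\<close>

lemma diameter_square_ge:
  assumes n: "n \<ge> 1" and dn: "dn \<ge> 2" and dm: "dm \<ge> 1" and sub: "histograms dm \<subseteq> histograms dn"
    and \<kappa>: "\<kappa> = 1 - \<alpha> - \<beta>" "0 < \<kappa>" "\<kappa> \<le> 1" and K: "2 < real K * \<kappa>"
    and M: "M \<ge> 8" "(97/100) ^ M < \<kappa>" and \<alpha>: "0 \<le> \<alpha>"
    and B: "B \<in> CS n (histograms dn) \<beta>" and \<delta>: "\<delta> > 0"
    and diam: "(SUP s\<in>densities (histograms dm). emeasure (sample_law n s)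
        {X \<in> space (sample_space n). diam_L2 (B X) > ennreal \<delta>}) \<le> ennreal \<alpha>"
  shows "min (\<kappa> / (32 * (real K)\<^sup>2) / (2 * real M)) (1 / (4 * real M))
    * max (sqrt (real dn) / real n) (real dm / real n) \<le> \<delta>\<^sup>2"
proof -
  obtain s_hat rho_hat where B_eq: "B = random_ball (histograms dn) s_hat rho_hat"
    and S: "s_hat \<in> measurable (sample_space n) L2_borel"
    and R: "rho_hat \<in> borel_measurable (sample_space n)"
    and cov: "\<forall>s\<in>densities (histograms dn). 1 - \<beta> \<le> measure (sample_law n s)
      {X \<in> space (sample_space n). s \<in> random_ball (histograms dn) s_hat rho_hat X}"
    using B unfolding CS_def by blast
  define C where "C = (\<lambda>s. {X \<in> space (sample_space n). s \<in> random_ball (histograms dn) s_hat rho_hat X})"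
  define G where "G = {X \<in> space (sample_space n). ennreal \<delta> < diam_L2 (random_ball (histograms dn) s_hat rho_hat X)}"
  have conf: "confidence_events n (densities (histograms dn)) C G \<beta> \<delta>"
    unfolding C_def G_def using dn \<delta> S R cov by (intro confidence_events_random_ball) auto
  have conf': "confidence_events n (densities (histograms dm)) C G \<beta> \<delta>"
    using conf by (rule confidence_events_subset) (use sub in \<open>auto simp: densities_def\<close>)
  have G: "measure (sample_law n s) G \<le> \<alpha>" if s: "s \<in> densities (histograms dm)" for s
  proof -
    interpret prob_space "sample_law n s" using s by (rule prob_space_sample_law)
    have "emeasure (sample_law n s) G \<le> ennreal \<alpha>"
      using SUP_upper[OF s, of "\<lambda>s. emeasure (sample_law n s) G"] diam
      unfolding G_def B_eq by (rule order_trans)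
    thus ?thesis using \<alpha> by (simp add: emeasure_eq_measure)
  qed
  have "hist dn (\<lambda>_. 1) = hist dm (\<lambda>_. 1)" by (auto simp: hist_def)
  moreover have "hist dm (\<lambda>_. 1) \<in> densities (histograms dm)"
    using dm by (intro hist_densities) auto
  ultimately have G1: "measure (sample_law n (hist dn (\<lambda>_. 1))) G \<le> \<alpha>" using G by simp
  define c1 where "c1 = \<kappa> / (32 * (real K)\<^sup>2)"
  define c where "c = min (c1 / (2 * real M)) (1 / (4 * real M))"
  have sq: "c1 * (sqrt (real dn) / real n) \<le> \<delta>\<^sup>2"
    unfolding c1_def using diameter_ge_sqrt_dimension[OF conf n dn \<kappa> K G1] .
  have c1: "0 \<le> c1" using \<kappa> by (simp add: c1_def)
  have "c1 / (2 * real M) \<le> c1 / 1" using c1 M by (intro divide_left_mono) auto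
  hence c: "0 \<le> c" "c \<le> c1" "c \<le> c1 / (2 * real M)" "c \<le> 1 / (4 * real M)"
    using c1 by (auto simp: c_def)
  have "c * (sqrt (real dn) / real n) \<le> c1 * (sqrt (real dn) / real n)"
    using c by (intro mult_right_mono) auto
  with sq have first: "c * (sqrt (real dn) / real n) \<le> \<delta>\<^sup>2" by simp
  have second: "c * (real dm / real n) \<le> \<delta>\<^sup>2"
  proof (cases "2 * M \<le> dm")
    case True
    have "c * (real dm / real n) \<le> 1 / (4 * real M) * (real dm / real n)"
      using c by (intro mult_right_mono) auto
    also have "\<dots> = real dm / (4 * real M * real n)" by simp
    also have "\<dots> \<le> \<delta>\<^sup>2"
      using diameter_ge_dimension[OF conf' n M(1) True _ G] M(2) \<kappa>(1) by simp
    finally show ?thesis .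
  next
    case False
    have "1 \<le> sqrt (real dn)" using dn by simp
    hence "2 * real M * 1 \<le> 2 * real M * sqrt (real dn)" by (intro mult_left_mono) auto
    moreover have "real dm \<le> real (2 * M)" using False by (intro of_nat_mono) simp
    ultimately have "real dm \<le> 2 * real M * sqrt (real dn)" by simp
    hence "c * (real dm / real n) \<le> c1 / (2 * real M) * (2 * real M * sqrt (real dn) / real n)"
      using c c1 by (intro mult_mono divide_right_mono) auto
    also have "\<dots> = c1 * (sqrt (real dn) / real n)" using M by simp
    finally show ?thesis using sq by simp
  qed
  show ?thesis using first second unfolding c_def c1_def by (simp add: max_def)
qed

theorem theorem4p2:
  fixes \<alpha> \<beta> :: real
  assumes "0 < \<alpha>" "\<alpha> < 1" "0 < \<beta>" "\<beta> < 1" "2 * \<alpha> + \<beta> < 1"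
  shows "\<exists>C>0. \<forall>(n::nat) (dn::nat) (dm::nat).
    n \<ge> 1 \<longrightarrow> dn \<ge> 2 \<longrightarrow> dm \<ge> 1 \<longrightarrow> histograms dm \<subseteq> histograms dn \<longrightarrow>
    (minimax_rate n \<alpha> \<beta> (histograms dn) (histograms dm))\<^sup>2
      \<ge> ennreal (C * max (sqrt (real dn) / real n) (real dm / real n))"
proof -
  define \<kappa> where "\<kappa> = 1 - \<alpha> - \<beta>"
  have \<kappa>: "0 < \<kappa>" "\<kappa> \<le> 1" using assms by (simp_all add: \<kappa>_def)
  obtain K :: nat where "2 / \<kappa> < real K" using reals_Archimedean2 by blast
  hence K: "2 < real K * \<kappa>" using \<kappa> by (simp add: field_simps)
  hence K0: "K > 0" by (cases K) auto
  obtain M0 where M0: "(97/100) ^ M0 < \<kappa>"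
    using real_arch_pow_inv[OF \<kappa>(1), of "97/100"] by auto
  define M where "M = max 8 M0"
  have "(97/100 :: real) ^ M \<le> (97/100) ^ M0" by (intro power_decreasing) (auto simp: M_def)
  with M0 have M: "(97/100) ^ M < \<kappa>" by linarith
  have M8: "M \<ge> 8" by (simp add: M_def)
  define C where "C = min (\<kappa> / (32 * (real K)\<^sup>2) / (2 * real M)) (1 / (4 * real M))"
  have C: "C > 0" using \<kappa> K0 M8 by (simp add: C_def)
  show ?thesis
  proof (intro exI[of _ C] conjI C allI impI)
    fix n dn dm :: nat
    assume n: "n \<ge> 1" and dn: "dn \<ge> 2" and dm: "dm \<ge> 1" and sub: "histograms dm \<subseteq> histograms dn"
    define r where "r = C * max (sqrt (real dn) / real n) (real dm / real n)"
    have r: "0 \<le> r" using C by (simp add: r_def le_max_iff_disj)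
    have "ennreal (sqrt r) \<le> minimax_rate n \<alpha> \<beta> (histograms dn) (histograms dm)"
      unfolding minimax_rate_def random_diam_def
    proof (intro INF_greatest Inf_greatest)
      fix B y
      assume B: "B \<in> CS n (histograms dn) \<beta>"
        and "y \<in> {ennreal \<delta> | \<delta>. \<delta> > 0 \<and> (SUP s\<in>densities (histograms dm). emeasure (sample_law n s)
          {X \<in> space (sample_space n). diam_L2 (B X) > ennreal \<delta>}) \<le> ennreal \<alpha>}"
      then obtain \<delta> where \<delta>: "y = ennreal \<delta>" "\<delta> > 0"
        "(SUP s\<in>densities (histograms dm). emeasure (sample_law n s)
          {X \<in> space (sample_space n). diam_L2 (B X) > ennreal \<delta>}) \<le> ennreal \<alpha>" by auto
      have "r \<le> \<delta>\<^sup>2"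
        unfolding r_def C_def
        using diameter_square_ge[OF n dn dm sub \<kappa>_def \<kappa> K M8 M _ B \<delta>(2,3)] assms(1) by simp
      hence "sqrt r \<le> \<delta>" using \<delta>(2) by (simp add: real_le_lsqrt)
      thus "ennreal (sqrt r) \<le> y" unfolding \<delta>(1) by (rule ennreal_leI)
    qed
    hence "(ennreal (sqrt r))\<^sup>2 \<le> (minimax_rate n \<alpha> \<beta> (histograms dn) (histograms dm))\<^sup>2"
      by (intro power_mono) auto
    moreover have "(ennreal (sqrt r))\<^sup>2 = ennreal r" using r by (simp add: ennreal_power)
    ultimately show "ennreal (C * max (sqrt (real dn) / real n) (real dm / real n))
        \<le> (minimax_rate n \<alpha> \<beta> (histograms dn) (histograms dm))\<^sup>2"
      by (simp add: r_def)
  qed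
qed

end
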